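(* For $n\ge 1$ let $b_{2n,n}$ be the number of permutations in $S_{2n}$ that contain an increasing subsequence of length $n$, i.e. whose longest increasing subsequence has length at least $n$. The sequence $(b_{2n,n})_{n\ge 1}$ is D-finite and satisfies a linear recurrence of order $4$ with polynomial coefficients: there exist univariate polynomials $p_0,\dots,p_4$ with $p_4\neq 0$ such that $$\sum_{i=0}^{4}p_i(n)\,b_{2(n+i),\,n+i}=0\qquad\text{for all } n\ge 1.$$
   Context: $S_n$ is the symmetric group on $\{1,\dots,n\}$; $b_{n,k}:=\#\{\sigma\in S_n\mid \mathrm{LIS}(\sigma)\ge k\}$, where $\mathrm{LIS}(\sigma)$ is the length of the longest increasing subsequence of $\sigma$. A univariate sequence is D-finite if it satisfies a nontrivial linear recurrence with polynomial coefficients in its index. *)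

theory Defs
  imports "HOL-Combinatorics.Permutations" "HOL-Computational_Algebra.Polynomial"
begin

(* A subsequence of sigma(1), ..., sigma(n) is given by its set of positions I. *)
definition LIS :: "nat \<Rightarrow> (nat \<Rightarrow> nat) \<Rightarrow> nat" where
  "LIS n \<sigma> = Max {card I | I. I \<subseteq> {1..n} \<and> strict_mono_on I \<sigma>}"

definition num_perms_LIS_ge :: "nat \<Rightarrow> nat \<Rightarrow> nat" where
  "num_perms_LIS_ge n k = card {\<sigma>. \<sigma> permutes {1..n} \<and> LIS n \<sigma> \<ge> k}"

(* Only p 0, ..., p r and the terms a N, a (N + 1), ... are relevant. *)
definition linear_recurrence_from ::
    "nat \<Rightarrow> nat \<Rightarrow> (nat \<Rightarrow> 'a::field_char_0 poly) \<Rightarrow> (nat \<Rightarrow> 'a) \<Rightarrow> bool" where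
  "linear_recurrence_from N r p a \<longleftrightarrow>
     (\<forall>n\<ge>N. (\<Sum>i\<le>r. poly (p i) (of_nat n) * a (n + i)) = 0)"

(* D-finiteness of the sequence (a n) with index n \<ge> N. *)
definition D_finite_from :: "nat \<Rightarrow> (nat \<Rightarrow> 'a::field_char_0) \<Rightarrow> bool" where
  "D_finite_from N a \<longleftrightarrow>
     (\<exists>r p. (\<exists>i\<le>r. p i \<noteq> 0) \<and> linear_recurrence_from N r p a)"

end

theory Submission
  imports Defs
begin

text \<open>
The proof has two parts: a single-sum formula for the numbers of permutations, and a
recurrence for the summands of that formula.

The formula: if \<open>1 \<le> k\<close> and \<open>n \<le> 2 k + 1\<close>, then the number of permutations of \<open>{1..n}\<close> with an
increasing subsequence of length \<open>k\<close> is
\<open>\<Sum>j = k..n. (-1) ^ (j - k) * ((2 j - 2) choose (j - k)) * (n choose j) * n! / j!\<close>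
(\<open>num_perms_LIS_ge_formula\<close>). Schensted insertion turns the length of the longest increasing
subsequence into the length of the first row, so the number is the sum of \<open>(f \<mu>)\<^sup>2\<close> over the
partitions \<open>\<mu>\<close> of \<open>n\<close> with \<open>k \<le> \<mu> 0\<close>, where \<open>f \<mu>\<close> counts the standard tableaux of shape \<open>\<mu>\<close>. Reversing one insertion gives a recursion for
the number of permutations with a given first row (\<open>card_arrangements_rec\<close>). The operators that
add or remove a box, in the first row or below it, satisfy four commutation relations, and moving
a box removal through a word of box additions by these relations produces the same recursion
(\<open>card_arrangements_eq_row_action\<close>).

To evaluate the sum, a partition \<open>\<mu>\<close> is encoded by its shifted parts \<open>\<mu> i + N - 1 - i\<close>, as usual for
fermions, and weights on partitions become alternating functions of \<open>N\<close> integer variables. Adding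
or removing a box becomes the sum of the unit shifts of the single variables: the terms that leave
the partitions vanish by antisymmetry. The condition \<open>k \<le> \<mu> 0\<close> becomes the one-body observable
which counts the variables that are at least \<open>N - 1 + k\<close>; here \<open>n \<le> 2 k + 1\<close> guarantees that at most
one variable is so large. Commuting a one-body operator with a sum of shifts yields a one-body
operator whose coefficient function is a difference of the old one, so everything reduces to
iterated differences of a step function, which are signed binomial coefficients
(\<open>raise_power_one_body_lower_power\<close>, \<open>sum_fdiff_bdiff_step\<close>).

The recurrence: for \<open>n = 2 k\<close> the summands are proper hypergeometric. In creative telescoping with
order four and with a polynomial of degree at most 16 in the summation index as the unknown part of
the certificate, the ansatz is a homogeneous linear system of 21 equations in 22 unknowns over
\<open>rat poly\<close>. It has a nontrivial solution for reasons of dimension (\<open>creative_telescoping\<close>). The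
recurrence part of the solution is nontrivial, because the homogeneous Gosper equation has no
nonzero polynomial solution. The leading coefficient of the recurrence can be made nonzero by
shifting the index (\<open>recurrence_with_top_coefficient\<close>).
\<close>

section \<open>First rows of insertion and longest increasing subsequences\<close>

text \<open>One step of Schensted insertion, seen on the first row only: an entry that is bumped
is forgotten.\<close>

definition insert_row :: "nat \<Rightarrow> nat set \<Rightarrow> nat set" where
  "insert_row x R = insert x (if \<exists>y\<in>R. x < y then R - {Min {y\<in>R. x < y}} else R)"

definition first_row :: "nat list \<Rightarrow> nat set" where
  "first_row xs = foldl (\<lambda>R x. insert_row x R) {} xs"

lemma first_row_Nil [simp]: "first_row [] = {}"
  and first_row_snoc [simp]: "first_row (xs @ [x]) = insert_row x (first_row xs)"
  by (simp_all add: first_row_def)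

lemma first_row_subset: "first_row xs \<subseteq> set xs"
  by (induction xs rule: rev_induct) (auto simp: insert_row_def split: if_splits)

lemma finite_first_row [simp]: "finite (first_row xs)"
  using first_row_subset finite_subset by blast

lemma bumped_entry:
  fixes R :: "nat set"
  assumes "finite R" "\<exists>y\<in>R. x < y"
  shows "Min {y\<in>R. x < y} \<in> R" "x < Min {y\<in>R. x < y}"
    "\<And>z. z \<in> R \<Longrightarrow> x < z \<Longrightarrow> Min {y\<in>R. x < y} \<le> z"
proof -
  have "Min {y\<in>R. x < y} \<in> {y\<in>R. x < y}"
    using assms by (intro Min_in) auto
  then show "Min {y\<in>R. x < y} \<in> R" "x < Min {y\<in>R. x < y}" by auto
  show "\<And>z. z \<in> R \<Longrightarrow> x < z \<Longrightarrow> Min {y\<in>R. x < y} \<le> z"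
    using assms by (intro Min_le) auto
qed

lemma insert_row_Int_le:
  assumes "finite R" "v \<le> x"
  shows "insert_row x R \<inter> {..<v} = R \<inter> {..<v}"
proof (cases "\<exists>y\<in>R. x < y")
  case True
  show ?thesis
    using bumped_entry[OF assms(1) True] assms True by (auto simp: insert_row_def)
next
  case False
  then show ?thesis using assms by (auto simp: insert_row_def)
qed

lemma card_insert_row:
  assumes fin: "finite R" and x: "x \<notin> R" and v: "x < v"
  shows "card (insert_row x R \<inter> {..<v})
       = max (card (R \<inter> {..<v})) (Suc (card (R \<inter> {..<x})))"
proof (cases "\<exists>y\<in>R. x < y \<and> y < v")
  case True
  then have ex: "\<exists>y\<in>R. x < y" by blast
  define m where "m = Min {y\<in>R. x < y}"
  note m = bumped_entry[OF fin ex, folded m_def]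
  have mv: "m < v" using True m(3) by fastforce
  have "insert_row x R \<inter> {..<v} = insert x (R \<inter> {..<v} - {m})"
    using ex v by (auto simp: insert_row_def m_def)
  then have 1: "card (insert_row x R \<inter> {..<v}) = card (R \<inter> {..<v})"
    using fin x m(1) mv card_Suc_Diff1[of "R \<inter> {..<v}" m] by (simp add: card_insert_if)
  have "insert m (R \<inter> {..<x}) \<subseteq> R \<inter> {..<v}"
    using m mv by auto
  then have "card (insert m (R \<inter> {..<x})) \<le> card (R \<inter> {..<v})"
    using fin by (intro card_mono) auto
  then have "Suc (card (R \<inter> {..<x})) \<le> card (R \<inter> {..<v})"
    using fin m by simp
  with 1 show ?thesis by simp
next
  case False
  have eq: "R \<inter> {..<v} = R \<inter> {..<x}"
    using False x v by (force simp: not_less order.order_iff_strict)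
  have "insert_row x R \<inter> {..<v} = insert x (R \<inter> {..<x})"
  proof (cases "\<exists>y\<in>R. x < y")
    case True
    note m = bumped_entry[OF fin True]
    have "v \<le> Min {y\<in>R. x < y}" using m False by (meson not_le)
    then have "(R - {Min {y\<in>R. x < y}}) \<inter> {..<v} = R \<inter> {..<v}" by auto
    then show ?thesis using True v eq by (simp add: insert_row_def)
  next
    case nex: False
    then show ?thesis using eq v by (simp add: insert_row_def)
  qed
  then show ?thesis using fin eq by simp
qed

text \<open>The entries of the first row below \<open>v\<close> count the longest increasing
subsequence with values below \<open>v\<close>. The bound \<open>v\<close> makes the induction
work: a subsequence that ends with the last entry extends one whose values lie below that
entry.\<close>

lemma increasing_subseq_card_le:
  assumes "inj_on \<sigma> {1..t}" "I \<subseteq> {1..t}" "strict_mono_on I \<sigma>" "\<forall>i\<in>I. \<sigma> i < v"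
  shows "card I \<le> card (first_row (map \<sigma> [1..<Suc t]) \<inter> {..<v})"
  using assms
proof (induction t arbitrary: I v)
  case 0
  then show ?case by simp
next
  case (Suc t)
  let ?R = "first_row (map \<sigma> [1..<Suc t])" and ?x = "\<sigma> (Suc t)"
  have row: "first_row (map \<sigma> [1..<Suc (Suc t)]) = insert_row ?x ?R"
    by (simp add: first_row_def)
  have inj: "inj_on \<sigma> {1..t}" using Suc.prems(1) by (rule inj_on_subset) auto
  have xR: "?x \<notin> ?R"
    using first_row_subset[of "map \<sigma> [1..<Suc t]"] Suc.prems(1)
    by (force simp: inj_on_def)
  have finI: "finite I" using Suc.prems(2) finite_subset by blast
  show ?case
  proof (cases "Suc t \<in> I")
    case False
    then have "I \<subseteq> {1..t}" using Suc.prems(2) by (auto simp: le_Suc_eq)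
    then have le: "card I \<le> card (?R \<inter> {..<v})"
      using Suc.IH[OF inj _ Suc.prems(3,4)] by blast
    show ?thesis
    proof (cases "?x < v")
      case True
      then show ?thesis using le card_insert_row[OF _ xR True] by (simp add: row)
    next
      case False
      then show ?thesis using le insert_row_Int_le[of ?R v ?x] by (simp add: row)
    qed
  next
    case True
    let ?J = "I - {Suc t}"
    have J: "?J \<subseteq> {1..t}" using Suc.prems(2) by (auto simp: le_Suc_eq)
    have "\<forall>i\<in>?J. \<sigma> i < ?x"
      using Suc.prems(3) True J by (auto simp: strict_mono_on_def subset_iff less_Suc_eq_le)
    moreover have "strict_mono_on ?J \<sigma>"
      using Suc.prems(3) by (auto simp: strict_mono_on_def)
    ultimately have "card ?J \<le> card (?R \<inter> {..<?x})"
      using Suc.IH[OF inj J] by blast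
    then have "card I \<le> Suc (card (?R \<inter> {..<?x}))"
      using card.remove[OF finI True] by simp
    moreover have "?x < v" using Suc.prems(4) True by blast
    ultimately show ?thesis using card_insert_row[OF _ xR, of v] by (simp add: row)
  qed
qed

lemma increasing_subseq_exists:
  assumes "inj_on \<sigma> {1..t}"
  shows "\<exists>I\<subseteq>{1..t}. strict_mono_on I \<sigma> \<and> (\<forall>i\<in>I. \<sigma> i < v) \<and>
           card I = card (first_row (map \<sigma> [1..<Suc t]) \<inter> {..<v})"
  using assms
proof (induction t arbitrary: v)
  case 0
  show ?case by (intro exI[of _ "{}"]) (auto simp: strict_mono_on_def)
next
  case (Suc t)
  let ?R = "first_row (map \<sigma> [1..<Suc t])" and ?x = "\<sigma> (Suc t)"
  have row: "first_row (map \<sigma> [1..<Suc (Suc t)]) = insert_row ?x ?R"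
    by (simp add: first_row_def)
  have inj: "inj_on \<sigma> {1..t}" using Suc.prems(1) by (rule inj_on_subset) auto
  have xR: "?x \<notin> ?R"
    using first_row_subset[of "map \<sigma> [1..<Suc t]"] Suc.prems(1)
    by (force simp: inj_on_def)
  have old: "\<exists>I\<subseteq>{1..Suc t}. strict_mono_on I \<sigma> \<and> (\<forall>i\<in>I. \<sigma> i < v) \<and> card I = card (?R \<inter> {..<v})"
  proof -
    obtain I where I: "I \<subseteq> {1..t}" "strict_mono_on I \<sigma>" "\<forall>i\<in>I. \<sigma> i < v"
      "card I = card (?R \<inter> {..<v})" using Suc.IH[OF inj, of v] by blast
    moreover have "I \<subseteq> {1..Suc t}" using I(1) by auto
    ultimately show ?thesis by blast
  qed
  show ?case
  proof (cases "?x < v")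
    case False
    then show ?thesis using old insert_row_Int_le[of ?R v ?x] by (simp add: row)
  next
    case True
    note card = card_insert_row[OF finite_first_row xR True]
    show ?thesis
    proof (cases "Suc (card (?R \<inter> {..<?x})) \<le> card (?R \<inter> {..<v})")
      case True
      then show ?thesis using old card by (simp add: row max_def)
    next
      case False
      obtain J where J: "J \<subseteq> {1..t}" "strict_mono_on J \<sigma>" "\<forall>i\<in>J. \<sigma> i < ?x"
        "card J = card (?R \<inter> {..<?x})" using Suc.IH[OF inj, of ?x] by blast
      let ?I = "insert (Suc t) J"
      have "finite J" using J(1) finite_subset by blast
      moreover have "Suc t \<notin> J" using J(1) by auto
      ultimately have "card ?I = card (first_row (map \<sigma> [1..<Suc (Suc t)]) \<inter> {..<v})"
        using J(4) card False by (simp add: row max_def)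
      moreover have "strict_mono_on ?I \<sigma>"
        using J(1-3) by (fastforce simp: strict_mono_on_def)
      moreover have "\<forall>i\<in>?I. \<sigma> i < v" using J(3) True by auto
      moreover have "?I \<subseteq> {1..Suc t}" using J(1) by auto
      ultimately show ?thesis by blast
    qed
  qed
qed

lemma LIS_eq_card_first_row:
  assumes "inj_on \<sigma> {1..n}"
  shows "LIS n \<sigma> = card (first_row (map \<sigma> [1..<Suc n]))"
proof -
  let ?R = "first_row (map \<sigma> [1..<Suc n])"
  define v where "v = Suc (Max (insert 0 (set (map \<sigma> [1..<Suc n]))))"
  have bound: "\<sigma> i < v" if "i \<in> {1..n}" for i
    unfolding v_def using that by (intro le_imp_less_Suc Max_ge) (auto simp del: upt_Suc)
  have R: "?R \<inter> {..<v} = ?R"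
    using first_row_subset[of "map \<sigma> [1..<Suc n]"] bound by force
  show ?thesis unfolding LIS_def
  proof (rule Max_eqI)
    have "{card I | I. I \<subseteq> {1..n} \<and> strict_mono_on I \<sigma>} \<subseteq> card ` Pow {1..n}" by auto
    then show "finite {card I | I. I \<subseteq> {1..n} \<and> strict_mono_on I \<sigma>}"
      using finite_subset by blast
  next
    fix y assume "y \<in> {card I | I. I \<subseteq> {1..n} \<and> strict_mono_on I \<sigma>}"
    then obtain I where "y = card I" "I \<subseteq> {1..n}" "strict_mono_on I \<sigma>" by blast
    then show "y \<le> card ?R"
      using increasing_subseq_card_le[OF assms, of I v] bound R by (metis subsetD)
  next
    show "card ?R \<in> {card I | I. I \<subseteq> {1..n} \<and> strict_mono_on I \<sigma>}"
      using increasing_subseq_exists[OF assms, of v] R by auto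
  qed
qed

definition arrangements :: "nat set \<Rightarrow> nat set \<Rightarrow> nat list set" where
  "arrangements A R = {xs. distinct xs \<and> set xs = A \<and> first_row xs = R}"

lemma finite_arrangements: "finite A \<Longrightarrow> finite (arrangements A R)"
  by (rule finite_subset[OF _ finite_lists_length_le[of A "card A"]])
     (auto simp: arrangements_def distinct_card)

text \<open>One step of insertion can be undone: either the new entry was appended, and then it is
the maximum of the row, or it bumped some \<open>y\<close>, and then it is the predecessor of
\<open>y\<close> in the new row.\<close>

lemma insert_row_eq_iff:
  assumes R': "finite R'" "x \<notin> R'"
  shows "insert_row x R' = R \<longleftrightarrow>
    finite R \<and> ((R \<noteq> {} \<and> x = Max R \<and> R' = R - {x}) \<or>
    (\<exists>y. y \<notin> R \<and> (\<exists>r\<in>R. r < y) \<and> x = Max {r\<in>R. r < y} \<and> R' = insert y (R - {x})))"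
    (is "_ \<longleftrightarrow> _ \<and> (?app \<or> ?bump)")
proof
  assume eq: "insert_row x R' = R"
  show "finite R \<and> (?app \<or> ?bump)"
  proof (cases "\<exists>y\<in>R'. x < y")
    case True
    define y where "y = Min {y\<in>R'. x < y}"
    note y = bumped_entry[OF R'(1) True, folded y_def]
    have R: "R = insert x (R' - {y})" using eq True by (simp add: insert_row_def y_def)
    have "y \<notin> R" "\<exists>r\<in>R. r < y" "R' = insert y (R - {x})" "finite R"
      using R y R' by auto
    moreover have "x = Max {r\<in>R. r < y}"
    proof (intro Max_eqI[symmetric])
      show "finite {r\<in>R. r < y}" using R R'(1) by simp
      show "x \<in> {r\<in>R. r < y}" using R y by simp
      fix z assume "z \<in> {r\<in>R. r < y}"
      then show "z \<le> x" using R y(3)[of z] by (auto simp: not_less[symmetric])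
    qed
    ultimately show ?thesis by (intro conjI disjI2 exI[of _ y])
  next
    case False
    then have R: "R = insert x R'" using eq by (simp add: insert_row_def)
    moreover have "Max R = x" unfolding R
      using False R' by (intro Max_eqI) (auto simp: not_less)
    ultimately show ?thesis using R' by auto
  qed
next
  assume *: "finite R \<and> (?app \<or> ?bump)"
  then have fin: "finite R" by blast
  from * have "?app \<or> ?bump" by blast
  then show "insert_row x R' = R"
  proof
    assume app: ?app
    then have "x \<in> R" using fin by simp
    moreover have "\<not> (\<exists>y\<in>R'. x < y)" using app fin by (auto simp: not_less)
    ultimately show ?thesis using app by (auto simp: insert_row_def)
  next
    assume ?bump
    then obtain y where y: "y \<notin> R" "\<exists>r\<in>R. r < y" and x: "x = Max {r\<in>R. r < y}"
      and R'_eq: "R' = insert y (R - {x})" by blast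
    have "x \<in> {r\<in>R. r < y}" unfolding x using y fin by (intro Max_in) auto
    then have xR: "x \<in> R" "x < y" by auto
    have "Min {z\<in>R'. x < z} = y"
    proof (rule Min_eqI)
      fix z assume z: "z \<in> {z\<in>R'. x < z}"
      show "y \<le> z"
      proof (rule ccontr)
        assume "\<not> y \<le> z"
        then have "z \<in> {r\<in>R. r < y}" using z R'_eq by auto
        then have "z \<le> x" unfolding x using fin by (intro Max_ge) auto
        then show False using z by auto
      qed
    qed (use R' R'_eq xR in auto)
    then show ?thesis using R'_eq xR y by (auto simp: insert_row_def)
  qed
qed

text \<open>The last entry is removed and the insertion undone. The sum ranges over the entry
\<open>y\<close> that was bumped. Since arrangements of arbitrary sets of values are counted, the
remaining values need no relabelling.\<close>

lemma card_arrangements_rec: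
  assumes fin: "finite A" and A: "A \<noteq> {}" and R: "R \<subseteq> A"
  shows "card (arrangements A R) =
      (if R = {} then 0 else card (arrangements (A - {Max R}) (R - {Max R}))) +
      (\<Sum>y | y \<in> A - R \<and> (\<exists>r\<in>R. r < y).
         card (arrangements (A - {Max {r\<in>R. r < y}}) (insert y (R - {Max {r\<in>R. r < y}}))))"
proof -
  have finR: "finite R" using R fin finite_subset by blast
  define Y where "Y = {y. y \<in> A - R \<and> (\<exists>r\<in>R. r < y)}"
  define b where "b = (\<lambda>y. Max {r\<in>R. r < y})"
  define P where "P = (\<lambda>y. arrangements (A - {b y}) (insert y (R - {b y})))"
  define P0 where "P0 = (if R = {} then {} else arrangements (A - {Max R}) (R - {Max R}))"
  have finY: "finite Y" using fin by (simp add: Y_def)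
  have bR: "b y \<in> R" "b y < y" if "y \<in> Y" for y
  proof -
    have "b y \<in> {r\<in>R. r < y}" unfolding b_def using that finR by (intro Max_in) (auto simp: Y_def)
    then show "b y \<in> R" "b y < y" by auto
  qed
  have MR: "Max R \<in> R" if "R \<noteq> {}" using that finR by simp
  have split: "arrangements A R =
      (\<lambda>ys. ys @ [Max R]) ` P0 \<union> (\<Union>y\<in>Y. (\<lambda>ys. ys @ [b y]) ` P y)" (is "_ = ?S0 \<union> ?S1")
  proof (intro equalityI subsetI)
    fix xs assume xs: "xs \<in> arrangements A R"
    then have "xs \<noteq> []" using A by (auto simp: arrangements_def)
    then obtain ys x where e: "xs = ys @ [x]" by (metis rev_exhaust)
    have d: "distinct ys" "x \<notin> set ys" "insert x (set ys) = A"
      and r: "insert_row x (first_row ys) = R"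
      using xs e by (auto simp: arrangements_def)
    have A': "set ys = A - {x}" using d by auto
    have "x \<notin> first_row ys" using d first_row_subset by blast
    from insert_row_eq_iff[OF finite_first_row this, of R] r
    have "(R \<noteq> {} \<and> x = Max R \<and> first_row ys = R - {x}) \<or>
      (\<exists>y. y \<notin> R \<and> (\<exists>r\<in>R. r < y) \<and> x = b y \<and> first_row ys = insert y (R - {x}))"
      by (simp add: b_def)
    then show "xs \<in> ?S0 \<union> ?S1"
    proof
      assume "R \<noteq> {} \<and> x = Max R \<and> first_row ys = R - {x}"
      then have "ys \<in> P0" "x = Max R" using d A' by (auto simp: P0_def arrangements_def)
      then show ?thesis using e by blast
    next
      assume "\<exists>y. y \<notin> R \<and> (\<exists>r\<in>R. r < y) \<and> x = b y \<and> first_row ys = insert y (R - {x})"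
      then obtain y where y: "y \<notin> R" "\<exists>r\<in>R. r < y" "x = b y" "first_row ys = insert y (R - {x})"
        by blast
      have "y \<in> A" using y(4) first_row_subset[of ys] A' by auto
      then have "y \<in> Y" using y by (auto simp: Y_def)
      moreover have "ys \<in> P y" using y d A' by (auto simp: P_def arrangements_def)
      ultimately show ?thesis using e y(3) by blast
    qed
  next
    fix xs assume "xs \<in> ?S0 \<union> ?S1"
    then show "xs \<in> arrangements A R"
    proof
      assume "xs \<in> ?S0"
      then obtain ys where ys: "xs = ys @ [Max R]" "ys \<in> P0" by blast
      then have ne: "R \<noteq> {}" and d: "distinct ys" "set ys = A - {Max R}" "first_row ys = R - {Max R}"
        by (auto simp: P0_def arrangements_def split: if_splits)
      have "insert_row (Max R) (first_row ys) = R"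
        using insert_row_eq_iff[of "first_row ys" "Max R" R] d ne finR by auto
      then show ?thesis using ys(1) d MR[OF ne] R by (auto simp: arrangements_def)
    next
      assume "xs \<in> ?S1"
      then obtain y ys where y: "y \<in> Y" and ys: "xs = ys @ [b y]" "ys \<in> P y" by blast
      then have d: "distinct ys" "set ys = A - {b y}" "first_row ys = insert y (R - {b y})"
        by (auto simp: P_def arrangements_def)
      have "insert_row (b y) (first_row ys) = R"
        using insert_row_eq_iff[of "first_row ys" "b y" R] d finR y bR[OF y]
        by (auto simp: b_def Y_def)
      then show ?thesis using ys(1) d bR(1)[OF y] R by (auto simp: arrangements_def)
    qed
  qed
  \<comment> \<open>The value bumped in the last step can be read off the penultimate row.\<close>
  have row0: "first_row (butlast xs) - R = {}" if xs: "xs \<in> ?S0" for xs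
  proof -
    obtain ys where ys: "xs = ys @ [Max R]" "ys \<in> P0" using xs by blast
    then have "first_row ys = R - {Max R}"
      by (simp add: P0_def arrangements_def split: if_splits)
    then show ?thesis unfolding ys(1) by (simp only: butlast_snoc) blast
  qed
  have row1: "first_row (butlast xs) - R = {y}"
    if y: "y \<in> Y" and xs: "xs \<in> (\<lambda>ys. ys @ [b y]) ` P y" for xs y
  proof -
    obtain ys where ys: "xs = ys @ [b y]" "ys \<in> P y" using xs by blast
    then have "first_row ys = insert y (R - {b y})"
      by (simp add: P_def arrangements_def)
    moreover have "y \<notin> R" using y by (simp add: Y_def)
    ultimately show ?thesis unfolding ys(1) by (simp only: butlast_snoc) blast
  qed
  have finP: "finite (P y)" for y using fin by (simp add: P_def finite_arrangements)
  have fin0: "finite P0" using fin by (simp add: P0_def finite_arrangements)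
  have inj: "inj_on (\<lambda>ys. ys @ [c]) S" for c :: nat and S by (simp add: inj_on_def)
  have "card (arrangements A R) = card ?S0 + card ?S1"
    unfolding split
  proof (rule card_Un_disjoint)
    show "?S0 \<inter> ?S1 = {}"
    proof (rule equals0I)
      fix xs assume xs: "xs \<in> ?S0 \<inter> ?S1"
      then obtain y where "y \<in> Y" "xs \<in> (\<lambda>ys. ys @ [b y]) ` P y" by blast
      from row1[OF this] row0[of xs] xs show False by simp
    qed
  qed (use fin0 finY finP in auto)
  also have "card ?S0 = card P0" by (rule card_image[OF inj])
  also have "card ?S1 = (\<Sum>y\<in>Y. card ((\<lambda>ys. ys @ [b y]) ` P y))"
  proof (rule card_UN_disjoint[OF finY])
    show "\<forall>i\<in>Y. \<forall>j\<in>Y. i \<noteq> j \<longrightarrow> (\<lambda>ys. ys @ [b i]) ` P i \<inter> (\<lambda>ys. ys @ [b j]) ` P j = {}"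
      using row1 by (metis (no_types, lifting) disjoint_iff singleton_inject)
  qed (use finP in auto)
  also have "\<dots> = (\<Sum>y\<in>Y. card (P y))" by (simp add: card_image[OF inj])
  finally show ?thesis by (simp add: P0_def P_def Y_def b_def)
qed

section \<open>Adding and removing boxes of partitions\<close>

type_synonym 'a weight = "(nat \<Rightarrow> nat) \<Rightarrow> 'a"

definition partitions :: "(nat \<Rightarrow> nat) set" where
  "partitions = {\<mu>. antimono \<mu> \<and> (\<exists>N. \<forall>i\<ge>N. \<mu> i = 0)}"

definition add_box :: "nat \<Rightarrow> (nat \<Rightarrow> nat) \<Rightarrow> (nat \<Rightarrow> nat)" where
  "add_box i \<mu> = \<mu>(i := Suc (\<mu> i))"

definition del_box :: "nat \<Rightarrow> (nat \<Rightarrow> nat) \<Rightarrow> (nat \<Rightarrow> nat)" where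
  "del_box i \<mu> = \<mu>(i := \<mu> i - 1)"

definition descents :: "(nat \<Rightarrow> nat) \<Rightarrow> nat set" where
  "descents \<mu> = {i. \<mu> (Suc i) < \<mu> i}"

text \<open>The operators act on weights, that is, on functions of partitions, and are therefore
the transposes of the operators on formal sums of partitions: \<open>up_first (down_first v)
\<mu>\<close> is the sum of \<open>v\<close> over the results of first adding a box to the first
row of \<open>\<mu>\<close> and then removing one.\<close>

definition up_first :: "rat weight \<Rightarrow> rat weight" where
  "up_first v \<mu> = v (add_box 0 \<mu>)"

definition up_lower :: "rat weight \<Rightarrow> rat weight" where
  "up_lower v \<mu> = (\<Sum>i\<in>descents \<mu>. v (add_box (Suc i) \<mu>))"

definition down_first :: "rat weight \<Rightarrow> rat weight" where
  "down_first v \<mu> = (if 0 \<in> descents \<mu> then v (del_box 0 \<mu>) else 0)"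

definition down_lower :: "rat weight \<Rightarrow> rat weight" where
  "down_lower v \<mu> = (\<Sum>i | Suc i \<in> descents \<mu>. v (del_box (Suc i) \<mu>))"

definition up :: "rat weight \<Rightarrow> rat weight" where
  "up v \<mu> = up_first v \<mu> + up_lower v \<mu>"

definition down :: "rat weight \<Rightarrow> rat weight" where
  "down v \<mu> = down_first v \<mu> + down_lower v \<mu>"

lemma zero_in_partitions: "(\<lambda>_. 0) \<in> partitions"
  by (auto simp: partitions_def antimono_def)

lemma partitions_iff:
  "\<mu> \<in> partitions \<longleftrightarrow> (\<forall>i. \<mu> (Suc i) \<le> \<mu> i) \<and> (\<exists>N. \<forall>i\<ge>N. \<mu> i = 0)"
  by (auto simp: partitions_def antimono_iff_le_Suc)

lemma finite_descents: "\<mu> \<in> partitions \<Longrightarrow> finite (descents \<mu>)"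
proof -
  assume "\<mu> \<in> partitions"
  then obtain N where "\<forall>i\<ge>N. \<mu> i = 0" by (auto simp: partitions_def)
  then have "descents \<mu> \<subseteq> {..<N}" by (force simp: descents_def not_less[symmetric])
  then show ?thesis using finite_subset by blast
qed

lemma finite_lower_descents: "\<mu> \<in> partitions \<Longrightarrow> finite {i. Suc i \<in> descents \<mu>}"
  using finite_vimageI[OF finite_descents, of \<mu> Suc] by (simp add: vimage_def)

lemma add_box_0_partition: "\<mu> \<in> partitions \<Longrightarrow> add_box 0 \<mu> \<in> partitions"
  unfolding partitions_iff add_box_def
proof safe
  fix N i assume h: "\<forall>i. \<mu> (Suc i) \<le> \<mu> i" and N: "\<forall>i\<ge>N. \<mu> i = 0"
  show "(\<mu>(0 := Suc (\<mu> 0))) (Suc i) \<le> (\<mu>(0 := Suc (\<mu> 0))) i"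
    using h by (cases i) (auto intro: le_SucI)
  show "\<exists>N. \<forall>i\<ge>N. (\<mu>(0 := Suc (\<mu> 0))) i = 0"
    using N by (intro exI[of _ "Suc N"]) auto
qed

lemma add_box_Suc_partition:
  "\<mu> \<in> partitions \<Longrightarrow> i \<in> descents \<mu> \<Longrightarrow> add_box (Suc i) \<mu> \<in> partitions"
  unfolding partitions_iff add_box_def descents_def
proof safe
  fix N j assume h: "\<forall>i. \<mu> (Suc i) \<le> \<mu> i" and N: "\<forall>i\<ge>N. \<mu> i = 0" and d: "\<mu> (Suc i) < \<mu> i"
  show "(\<mu>(Suc i := Suc (\<mu> (Suc i)))) (Suc j) \<le> (\<mu>(Suc i := Suc (\<mu> (Suc i)))) j"
    using h d by (auto intro: le_SucI)
  show "\<exists>N. \<forall>j\<ge>N. (\<mu>(Suc i := Suc (\<mu> (Suc i)))) j = 0"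
    using N by (intro exI[of _ "Suc (N + Suc i)"]) auto
qed

lemma del_box_partition:
  "\<mu> \<in> partitions \<Longrightarrow> i \<in> descents \<mu> \<Longrightarrow> del_box i \<mu> \<in> partitions"
  unfolding partitions_iff del_box_def descents_def
proof safe
  fix N j assume h: "\<forall>i. \<mu> (Suc i) \<le> \<mu> i" and N: "\<forall>i\<ge>N. \<mu> i = 0" and d: "\<mu> (Suc i) < \<mu> i"
  show "(\<mu>(i := \<mu> i - 1)) (Suc j) \<le> (\<mu>(i := \<mu> i - 1)) j"
    using h d by (auto intro: le_trans[OF diff_le_self])
  show "\<exists>N. \<forall>j\<ge>N. (\<mu>(i := \<mu> i - 1)) j = 0"
    using N by (intro exI[of _ N]) auto
qed

lemma up_first_down_first: "\<mu> \<in> partitions \<Longrightarrow> up_first (down_first v) \<mu> = v \<mu>"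
  by (auto simp: up_first_def down_first_def descents_def add_box_def del_box_def
      partitions_iff less_Suc_eq_le)

lemma up_first_down_lower: "up_first (down_lower v) = down_lower (up_first v)"
proof
  fix \<mu>
  have "{i. Suc i \<in> descents (add_box 0 \<mu>)} = {i. Suc i \<in> descents \<mu>}"
    by (auto simp: descents_def add_box_def)
  moreover have "del_box (Suc i) (add_box 0 \<mu>) = add_box 0 (del_box (Suc i) \<mu>)" for i
    by (auto simp: del_box_def add_box_def)
  ultimately show "up_first (down_lower v) \<mu> = down_lower (up_first v) \<mu>"
    by (simp add: up_first_def down_lower_def)
qed

lemma up_lower_down_first:
  assumes "\<mu> \<in> partitions"
  shows "up_lower (down_first v) \<mu> = down_first (up_lower v) \<mu>"
proof -
  have comm: "del_box 0 (add_box (Suc i) \<mu>) = add_box (Suc i) (del_box 0 \<mu>)" for i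
    by (auto simp: del_box_def add_box_def)
  have iff: "(i \<in> descents \<mu> \<and> 0 \<in> descents (add_box (Suc i) \<mu>)) \<longleftrightarrow>
      (0 \<in> descents \<mu> \<and> i \<in> descents (del_box 0 \<mu>))" for i
    by (cases i) (auto simp: descents_def add_box_def del_box_def)
  note fin = finite_descents[OF assms]
  have "up_lower (down_first v) \<mu> =
      (\<Sum>i | i \<in> descents \<mu> \<and> 0 \<in> descents (add_box (Suc i) \<mu>). v (del_box 0 (add_box (Suc i) \<mu>)))"
    unfolding up_lower_def down_first_def
    by (rule sum.mono_neutral_cong_right) (use fin in auto)
  also have "\<dots> = down_first (up_lower v) \<mu>"
    unfolding iff comm by (simp add: up_lower_def down_first_def)
  finally show ?thesis .
qed

text \<open>The boxes that are added and removed can be exchanged if they differ. If they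
coincide, the lower box can be any addable one, and the row \<open>Suc i\<close> admits a new box
if and only if the row \<open>i\<close> admits the removal of one. So a removable box in the first
row leaves one diagonal term over, and this is \<open>down_first (up_first v)\<close>.\<close>

lemma up_lower_down_lower:
  assumes "\<mu> \<in> partitions"
  shows "up_lower (down_lower v) \<mu> = down_lower (up_lower v) \<mu> + down_first (up_first v) \<mu>"
proof -
  let ?D = "descents \<mu>" and ?L = "{i. Suc i \<in> descents \<mu>}"
  note fin = finite_descents[OF assms] finite_lower_descents[OF assms]
  define g where "g = (\<lambda>i j. v (del_box (Suc j) (add_box (Suc i) \<mu>)))"
  define X where "X = (\<lambda>i. {j. Suc j \<in> descents (add_box (Suc i) \<mu>)})"
  define Y where "Y = (\<lambda>j. descents (del_box (Suc j) \<mu>))"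
  have finX: "finite (X i)" if "i \<in> ?D" for i
    unfolding X_def by (rule finite_lower_descents[OF add_box_Suc_partition[OF assms that]])
  have finY: "finite (Y j)" if "j \<in> ?L" for j
    unfolding Y_def using that by (intro finite_descents del_box_partition[OF assms]) simp
  have diag: "del_box (Suc i) (add_box (Suc i) \<mu>) = \<mu>" for i
    by (auto simp: del_box_def add_box_def)
  have comm: "add_box (Suc i) (del_box (Suc j) \<mu>) = del_box (Suc j) (add_box (Suc i) \<mu>)"
    if "j \<in> ?L" for i j
    using that by (auto simp: del_box_def add_box_def descents_def fun_eq_iff)
  have mono: "\<mu> (Suc i) \<le> \<mu> i" for i using assms by (simp add: partitions_iff)
  have dX: "i \<in> X i" for i
    using mono[of "Suc i"] by (simp add: X_def descents_def add_box_def less_Suc_eq_le)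
  have dY: "j \<in> Y j" if "j \<in> ?L" for j
    using that mono[of j] by (auto simp: Y_def descents_def del_box_def)
  have off: "Sigma ?D (\<lambda>i. X i - {i}) = {(i, j). j \<in> ?L \<and> i \<in> Y j \<and> i \<noteq> j}"
    by (auto simp: X_def Y_def descents_def del_box_def add_box_def split: if_splits)
  have "up_lower (down_lower v) \<mu> = (\<Sum>i\<in>?D. \<Sum>j\<in>X i. g i j)"
    by (simp add: up_lower_def down_lower_def X_def g_def)
  also have "\<dots> = (\<Sum>i\<in>?D. v \<mu> + (\<Sum>j\<in>X i - {i}. g i j))"
    using finX dX by (intro sum.cong refl) (subst sum.remove[where x = "i" for i], auto simp: g_def diag)
  also have "\<dots> = of_nat (card ?D) * v \<mu> + (\<Sum>i\<in>?D. \<Sum>j\<in>X i - {i}. g i j)"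
    by (simp add: sum.distrib)
  also have "(\<Sum>i\<in>?D. \<Sum>j\<in>X i - {i}. g i j) = (\<Sum>(i, j)\<in>Sigma ?D (\<lambda>i. X i - {i}). g i j)"
    by (subst sum.Sigma) (use fin finX in auto)
  also have "\<dots> = (\<Sum>(j, i)\<in>Sigma ?L (\<lambda>j. Y j - {j}). g i j)"
    unfolding off
    by (rule sum.reindex_bij_witness[of _ "\<lambda>(j, i). (i, j)" "\<lambda>(i, j). (j, i)"]) auto
  also have "\<dots> = (\<Sum>j\<in>?L. \<Sum>i\<in>Y j - {j}. g i j)"
    by (subst sum.Sigma) (use fin finY in auto)
  finally have 1: "up_lower (down_lower v) \<mu> =
      of_nat (card ?D) * v \<mu> + (\<Sum>j\<in>?L. \<Sum>i\<in>Y j - {j}. g i j)" .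
  have "down_lower (up_lower v) \<mu> = (\<Sum>j\<in>?L. \<Sum>i\<in>Y j. v (add_box (Suc i) (del_box (Suc j) \<mu>)))"
    by (simp add: up_lower_def down_lower_def Y_def)
  also have "\<dots> = (\<Sum>j\<in>?L. \<Sum>i\<in>Y j. g i j)"
    by (intro sum.cong refl) (simp add: comm g_def)
  also have "\<dots> = (\<Sum>j\<in>?L. v \<mu> + (\<Sum>i\<in>Y j - {j}. g i j))"
    using finY dY by (intro sum.cong refl) (subst sum.remove[where x = "j" for j], auto simp: g_def diag)
  also have "\<dots> = of_nat (card ?L) * v \<mu> + (\<Sum>j\<in>?L. \<Sum>i\<in>Y j - {j}. g i j)"
    by (simp add: sum.distrib)
  finally have 2: "down_lower (up_lower v) \<mu> =
      of_nat (card ?L) * v \<mu> + (\<Sum>j\<in>?L. \<Sum>i\<in>Y j - {j}. g i j)" .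
  have 3: "down_first (up_first v) \<mu> = (if 0 \<in> ?D then 1 else 0) * v \<mu>"
    by (auto simp: down_first_def up_first_def descents_def del_box_def add_box_def)
  have "?D = (if 0 \<in> ?D then {0} else {}) \<union> Suc ` ?L"
    by (auto simp: image_iff) (metis not0_implies_Suc)+
  then have "card ?D = card ((if 0 \<in> ?D then {0} else {}) \<union> Suc ` ?L)" by simp
  also have "\<dots> = (if 0 \<in> ?D then 1 else 0) + card ?L"
    using fin by (subst card_Un_disjoint) (auto simp: card_image)
  finally show ?thesis unfolding 1 2 3 by (simp add: algebra_simps)
qed

section \<open>Permutations with a given first row\<close>

text \<open>The set \<open>A\<close> in increasing order is read as a word: an element adds a box
to the first row if it lies in \<open>R\<close>, and to a lower row otherwise. This is the growth
of a standard tableau with entries \<open>A\<close> and first row \<open>R\<close>.\<close>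

definition row_action :: "nat set \<Rightarrow> nat set \<Rightarrow> rat weight \<Rightarrow> rat weight" where
  "row_action A R v = foldr (\<lambda>a. if a \<in> R then up_first else up_lower) (sorted_list_of_set A) v"

lemma row_action_empty [simp]: "row_action {} R v = v"
  by (simp add: row_action_def)

lemma row_action_insert:
  assumes "finite A" "\<forall>a\<in>A. a < b"
  shows "row_action (insert b A) R v = row_action A R (if b \<in> R then up_first v else up_lower v)"
proof -
  have "sorted_list_of_set (insert b A) = sorted_list_of_set A @ [b]"
    using assms
    by (intro sorted_distinct_set_unique)
       (auto simp: sorted_append less_imp_le simp del: sorted_list_of_set_insert_remove)
  then show ?thesis by (simp add: row_action_def)
qed

lemma row_action_cong:
  assumes "finite A" "\<And>\<mu>. \<mu> \<in> partitions \<Longrightarrow> v \<mu> = w \<mu>" "R \<inter> A = S \<inter> A" "\<mu> \<in> partitions"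
  shows "row_action A R v \<mu> = row_action A S w \<mu>"
  using assms
proof (induction A arbitrary: v w \<mu> rule: finite_linorder_max_induct)
  case empty
  then show ?case by simp
next
  case (insert b A)
  have "(b \<in> R) = (b \<in> S)" and RS: "R \<inter> A = S \<inter> A" using insert.prems(2) by auto
  then show ?case
    using insert.hyps(1,2) insert.prems(1,3)
    by (auto simp: row_action_insert up_first_def up_lower_def add_box_0_partition add_box_Suc_partition
        intro!: insert.IH sum.cong)
qed

lemma row_action_add: "finite A \<Longrightarrow> row_action A R (\<lambda>\<mu>. v \<mu> + w \<mu>) = (\<lambda>\<mu>. row_action A R v \<mu> + row_action A R w \<mu>)"
proof (induction A arbitrary: v w rule: finite_linorder_max_induct)
  case (insert b A)
  have "up_first (\<lambda>\<mu>. v \<mu> + w \<mu>) = (\<lambda>\<mu>. up_first v \<mu> + up_first w \<mu>)"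
    "up_lower (\<lambda>\<mu>. v \<mu> + w \<mu>) = (\<lambda>\<mu>. up_lower v \<mu> + up_lower w \<mu>)"
    by (auto simp: up_first_def up_lower_def sum.distrib)
  then show ?case using insert by (simp add: row_action_insert)
qed simp

abbreviation empty_partition :: "nat \<Rightarrow> nat" where
  "empty_partition \<equiv> (\<lambda>_. 0)"

text \<open>The removal moves to the left through the word. It passes the additions to lower rows
and cancels the first addition to the first row that it meets, which belongs to the maximum of
\<open>R \<inter> A\<close>. If there is none, it reaches the empty partition and vanishes
there.\<close>

lemma row_action_down_first:
  assumes "finite A"
  shows "row_action A R (down_first v) empty_partition =
    (if R \<inter> A = {} then 0 else row_action (A - {Max (R \<inter> A)}) R v empty_partition)"
  using assms
proof (induction A arbitrary: v rule: finite_linorder_max_induct)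
  case empty
  then show ?case by (simp add: down_first_def descents_def)
next
  case (insert b A)
  have bA: "b \<notin> A" using insert.hyps(2) by blast
  show ?case
  proof (cases "b \<in> R")
    case True
    have "Max (R \<inter> insert b A) = b"
      using True insert.hyps by (intro Max_eqI) (auto simp: less_imp_le)
    moreover have "row_action A R (up_first (down_first v)) empty_partition = row_action A R v empty_partition"
      by (rule row_action_cong) (use insert.hyps in \<open>auto simp: up_first_down_first zero_in_partitions\<close>)
    ultimately show ?thesis using True bA insert.hyps by (auto simp: row_action_insert)
  next
    case False
    have eq: "row_action A R (up_lower (down_first v)) empty_partition
        = row_action A R (down_first (up_lower v)) empty_partition"
      by (rule row_action_cong) (use insert.hyps in \<open>auto simp: up_lower_down_first zero_in_partitions\<close>)
    have RA: "R \<inter> insert b A = R \<inter> A" using False by auto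
    show ?thesis
    proof (cases "R \<inter> A = {}")
      case True
      then show ?thesis using RA False insert eq by (simp add: row_action_insert)
    next
      case ne: False
      let ?m = "Max (R \<inter> A)"
      have "?m \<in> R \<inter> A" using insert.hyps(1) ne by (intro Max_in) auto
      then have "insert b A - {?m} = insert b (A - {?m})" using False by auto
      then show ?thesis using RA ne False insert eq by (simp add: row_action_insert)
    qed
  qed
qed

text \<open>The removal moves to the left through the word. It passes the additions to the first
row. At an addition \<open>y\<close> to a lower row it either passes, or it turns this addition
into one to the first row and itself into a removal from the first row, which then cancels the
preceding element of \<open>R\<close>. This is the reverse of bumping \<open>y\<close>.\<close>

lemma row_action_down_lower:
  assumes "finite A"
  shows "row_action A R (down_lower v) empty_partition =
    (\<Sum>y | y \<in> A - R \<and> (\<exists>r\<in>R \<inter> A. r < y).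
       row_action (A - {Max {r\<in>R \<inter> A. r < y}}) (insert y R) v empty_partition)"
  using assms
proof (induction A arbitrary: v rule: finite_linorder_max_induct)
  case empty
  then show ?case by (simp add: down_lower_def descents_def)
next
  case (insert b A)
  let ?Y = "\<lambda>A. {y. y \<in> A - R \<and> (\<exists>r\<in>R \<inter> A. r < y)}"
  let ?x = "\<lambda>A y. Max {r\<in>R \<inter> A. r < y}"
  have bA: "b \<notin> A" using insert.hyps(2) by blast
  have below: "{r\<in>R \<inter> insert b A. r < y} = {r\<in>R \<inter> A. r < y}" if "y \<in> insert b A" for y
    using that insert.hyps(2) by (auto dest: less_asym)
  have xA: "?x A y \<in> R \<inter> A" "?x A y < y" if "\<exists>r\<in>R \<inter> A. r < y" for y
  proof -
    have "?x A y \<in> {r\<in>R \<inter> A. r < y}" using that insert.hyps(1) by (intro Max_in) auto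
    then show "?x A y \<in> R \<inter> A" "?x A y < y" by auto
  qed
  have del: "insert b A - {?x A y} = insert b (A - {?x A y})" if "\<exists>r\<in>R \<inter> A. r < y" for y
    using xA[OF that] bA by auto
  have lt: "\<forall>a\<in>A - {z}. a < b" for z using insert.hyps(2) by auto
  have step: "row_action (insert b A - {?x (insert b A) y}) (insert y R) v empty_partition =
      row_action (A - {?x A y}) (insert y R) (if b \<in> R then up_first v else up_lower v) empty_partition"
    if "y \<in> ?Y A" for y
  proof -
    have ex: "\<exists>r\<in>R \<inter> A. r < y" and "y \<in> A" using that by auto
    have "b \<noteq> y" using \<open>y \<in> A\<close> bA by auto
    have "row_action (insert b (A - {?x A y})) (insert y R) v =
        row_action (A - {?x A y}) (insert y R) (if b \<in> R then up_first v else up_lower v)"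
      using row_action_insert[OF _ lt, of "?x A y" "insert y R" v] insert.hyps(1) \<open>b \<noteq> y\<close> by simp
    then show ?thesis using del[OF ex] below \<open>y \<in> A\<close> by simp
  qed
  show ?case
  proof (cases "b \<in> R")
    case True
    have Y: "?Y (insert b A) = ?Y A"
      using True insert.hyps(2) by (auto dest: less_asym)
    have "row_action (insert b A) R (down_lower v) empty_partition
        = row_action A R (down_lower (up_first v)) empty_partition"
      using True insert.hyps by (simp add: row_action_insert up_first_down_lower)
    also have "\<dots> = (\<Sum>y\<in>?Y A. row_action (A - {?x A y}) (insert y R) (up_first v) empty_partition)"
      by (rule insert.IH)
    also have "\<dots> = (\<Sum>y\<in>?Y A. row_action (insert b A - {?x (insert b A) y}) (insert y R) v empty_partition)"
      using True by (intro sum.cong refl) (subst step, auto)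
    finally show ?thesis unfolding Y .
  next
    case False
    let ?Z = "if R \<inter> A = {} then {} else {b}"
    have Y: "?Y (insert b A) = ?Y A \<union> ?Z"
      using False insert.hyps(2) bA by auto
    have "row_action (insert b A) R (down_lower v) empty_partition
        = row_action A R (\<lambda>\<mu>. down_lower (up_lower v) \<mu> + down_first (up_first v) \<mu>) empty_partition"
      using False insert.hyps
      by (simp add: row_action_insert, intro row_action_cong) (auto simp: up_lower_down_lower zero_in_partitions)
    also have "\<dots> = row_action A R (down_lower (up_lower v)) empty_partition
        + row_action A R (down_first (up_first v)) empty_partition"
      by (simp add: row_action_add insert.hyps)
    also have "row_action A R (down_lower (up_lower v)) empty_partition =
        (\<Sum>y\<in>?Y A. row_action (A - {?x A y}) (insert y R) (up_lower v) empty_partition)"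
      by (rule insert.IH)
    also have "\<dots> = (\<Sum>y\<in>?Y A. row_action (insert b A - {?x (insert b A) y}) (insert y R) v empty_partition)"
      using False by (intro sum.cong refl) (subst step, auto)
    also have "row_action A R (down_first (up_first v)) empty_partition =
        (\<Sum>y\<in>?Z. row_action (insert b A - {?x (insert b A) y}) (insert y R) v empty_partition)"
    proof (cases "R \<inter> A = {}")
      case True
      then show ?thesis using row_action_down_first[OF insert.hyps(1)] by simp
    next
      case ne: False
      have xb: "?x (insert b A) b = Max (R \<inter> A)"
        using insert.hyps(2) False by (intro arg_cong[where f = Max]) auto
      have ex: "\<exists>r\<in>R \<inter> A. r < b" using ne insert.hyps(2) by auto
      have Mb: "?x A b = Max (R \<inter> A)"
        using insert.hyps(2) by (intro arg_cong[where f = Max]) auto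
      let ?B = "A - {Max (R \<inter> A)}"
      have "row_action (insert b A - {?x (insert b A) b}) (insert b R) v empty_partition
          = row_action (insert b ?B) (insert b R) v empty_partition"
        using del[OF ex] unfolding xb Mb by simp
      also have "\<dots> = row_action ?B (insert b R) (up_first v) empty_partition"
        using row_action_insert[OF _ lt, of "Max (R \<inter> A)" "insert b R" v] insert.hyps(1) by simp
      also have "\<dots> = row_action ?B R (up_first v) empty_partition"
        by (rule row_action_cong) (use insert.hyps bA in \<open>auto simp: zero_in_partitions\<close>)
      finally show ?thesis using ne row_action_down_first[OF insert.hyps(1)] by simp
    qed
    also have "(\<Sum>y\<in>?Y A. row_action (insert b A - {?x (insert b A) y}) (insert y R) v empty_partition) +
        (\<Sum>y\<in>?Z. row_action (insert b A - {?x (insert b A) y}) (insert y R) v empty_partition) =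
        (\<Sum>y\<in>?Y A \<union> ?Z. row_action (insert b A - {?x (insert b A) y}) (insert y R) v empty_partition)"
      by (rule sum.union_disjoint[symmetric]) (use insert.hyps bA in auto)
    finally show ?thesis unfolding Y .
  qed
qed

text \<open>The number of standard tableaux of shape \<open>\<mu>\<close> if \<open>\<mu>\<close>
has \<open>m\<close> boxes, and \<open>0\<close> otherwise.\<close>

fun num_tableaux :: "nat \<Rightarrow> rat weight" where
  "num_tableaux 0 = (\<lambda>\<mu>. if \<mu> = empty_partition then 1 else 0)"
| "num_tableaux (Suc m) = down (num_tableaux m)"

text \<open>Both sides satisfy the same recursion: on the left, reverse insertion; on the right,
the recursion of \<open>num_tableaux\<close> with the removal moved through the word.\<close>

lemma card_arrangements_eq_row_action:
  assumes "finite A" "R \<subseteq> A"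
  shows "of_nat (card (arrangements A R)) = row_action A R (num_tableaux (card A)) empty_partition"
  using assms
proof (induction "card A" arbitrary: A R)
  case 0
  then have "A = {}" "R = {}" by auto
  moreover have "arrangements {} {} = {[]}" by (auto simp: arrangements_def)
  ultimately show ?case by simp
next
  case (Suc m)
  have finA: "finite A" and "A \<noteq> {}" using Suc.hyps(2) by (auto intro: card_ge_0_finite)
  have finR: "finite R" using Suc.prems finite_subset by blast
  have RA: "R \<inter> A = R" using Suc.prems by blast
  let ?f = "num_tableaux m"
  let ?Y = "{y. y \<in> A - R \<and> (\<exists>r\<in>R. r < y)}"
  let ?x = "\<lambda>y. Max {r\<in>R. r < y}"
  have IH: "of_nat (card (arrangements (A - {a}) S)) = row_action (A - {a}) S ?f empty_partition"
    if "a \<in> A" "S \<subseteq> A - {a}" for a S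
  proof -
    have "card (A - {a}) = m" using Suc.hyps(2) that(1) by simp
    then show ?thesis using Suc.hyps(1)[of "A - {a}" S] that finA by simp
  qed
  have xR: "?x y \<in> R" "?x y < y" if "y \<in> ?Y" for y
  proof -
    have "?x y \<in> {r\<in>R. r < y}" using that finR by (intro Max_in) auto
    then show "?x y \<in> R" "?x y < y" by auto
  qed
  have 1: "(if R = {} then 0 else of_nat (card (arrangements (A - {Max R}) (R - {Max R})))) =
      row_action A R (down_first ?f) empty_partition"
  proof (cases "R = {}")
    case True
    then show ?thesis using row_action_down_first[OF finA, of R] by simp
  next
    case False
    then have "Max R \<in> R" using finR by simp
    then have "of_nat (card (arrangements (A - {Max R}) (R - {Max R})))
        = row_action (A - {Max R}) (R - {Max R}) ?f empty_partition"
      using Suc.prems by (intro IH) auto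
    also have "\<dots> = row_action (A - {Max R}) R ?f empty_partition"
      by (rule row_action_cong) (use finA in \<open>auto simp: zero_in_partitions\<close>)
    finally show ?thesis using False row_action_down_first[OF finA, of R] RA by simp
  qed
  have 2: "(\<Sum>y\<in>?Y. of_nat (card (arrangements (A - {?x y}) (insert y (R - {?x y}))))) =
      row_action A R (down_lower ?f) empty_partition"
    unfolding row_action_down_lower[OF finA] RA
  proof (rule sum.cong[OF refl])
    fix y assume y: "y \<in> ?Y"
    have "of_nat (card (arrangements (A - {?x y}) (insert y (R - {?x y}))))
        = row_action (A - {?x y}) (insert y (R - {?x y})) ?f empty_partition"
      using Suc.prems y xR[OF y] by (intro IH) auto
    also have "\<dots> = row_action (A - {?x y}) (insert y R) ?f empty_partition"
      by (rule row_action_cong) (use finA in \<open>auto simp: zero_in_partitions\<close>)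
    finally show "of_nat (card (arrangements (A - {?x y}) (insert y (R - {?x y}))))
        = row_action (A - {?x y}) (insert y R) ?f empty_partition" .
  qed
  have "of_nat (card (arrangements A R)) =
      row_action A R (down_first ?f) empty_partition + row_action A R (down_lower ?f) empty_partition"
    unfolding card_arrangements_rec[OF finA \<open>A \<noteq> {}\<close> Suc.prems(2)] 1[symmetric] 2[symmetric]
    by simp
  also have "\<dots> = row_action A R (down ?f) empty_partition"
    using row_action_add[OF finA, of R "down_first ?f" "down_lower ?f"]
    by (simp add: down_def[abs_def])
  finally show ?case by (simp flip: Suc.hyps(2))
qed

lemma row_action_first_row_length:
  assumes "finite A"
  shows "row_action A R (\<lambda>\<mu>. \<phi> (\<mu> 0) * v \<mu>) \<nu> = \<phi> (\<nu> 0 + card (R \<inter> A)) * row_action A R v \<nu>"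
  using assms
proof (induction A arbitrary: \<phi> v rule: finite_linorder_max_induct)
  case (insert b A)
  have bA: "b \<notin> A" using insert.hyps(2) by blast
  show ?case
  proof (cases "b \<in> R")
    case True
    have "up_first (\<lambda>\<mu>. \<phi> (\<mu> 0) * v \<mu>) = (\<lambda>\<mu>. \<phi> (Suc (\<mu> 0)) * up_first v \<mu>)"
      by (auto simp: up_first_def add_box_def)
    then show ?thesis
      using True insert.hyps bA insert.IH[of "\<lambda>k. \<phi> (Suc k)"]
      by (simp add: row_action_insert Int_insert_right)
  next
    case False
    have "up_lower (\<lambda>\<mu>. \<phi> (\<mu> 0) * v \<mu>) = (\<lambda>\<mu>. \<phi> (\<mu> 0) * up_lower v \<mu>)"
      by (auto simp: up_lower_def add_box_def sum_distrib_left)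
    then show ?thesis
      using False insert.hyps insert.IH by (simp add: row_action_insert)
  qed
qed simp

lemma sum_row_action_subsets:
  assumes "finite A"
  shows "(\<Sum>R\<in>Pow A. row_action A R v \<nu>) = (up ^^ card A) v \<nu>"
  using assms
proof (induction A arbitrary: v rule: finite_linorder_max_induct)
  case (insert b A)
  have bA: "b \<notin> A" using insert.hyps(2) by blast
  have cong: "row_action A (insert b R) w = row_action A R w" for R w
    using bA by (auto simp: row_action_def insert.hyps intro!: foldr_cong[THEN fun_cong])
  have inj: "inj_on (insert b) (Pow A)" using bA by (auto simp: inj_on_def)
  have "(\<Sum>R\<in>Pow (insert b A). row_action (insert b A) R v \<nu>) =
      (\<Sum>R\<in>Pow A. row_action (insert b A) R v \<nu>) + (\<Sum>R\<in>insert b ` Pow A. row_action (insert b A) R v \<nu>)"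
    unfolding Pow_insert by (rule sum.union_disjoint) (use insert.hyps bA in auto)
  also have "(\<Sum>R\<in>Pow A. row_action (insert b A) R v \<nu>) = (\<Sum>R\<in>Pow A. row_action A R (up_lower v) \<nu>)"
    using insert.hyps bA by (intro sum.cong refl) (auto simp: row_action_insert)
  also have "(\<Sum>R\<in>insert b ` Pow A. row_action (insert b A) R v \<nu>) = (\<Sum>R\<in>Pow A. row_action A R (up_first v) \<nu>)"
    using insert.hyps inj by (simp add: sum.reindex row_action_insert cong)
  also have "(\<Sum>R\<in>Pow A. row_action A R (up_lower v) \<nu>) + (\<Sum>R\<in>Pow A. row_action A R (up_first v) \<nu>) =
      (\<Sum>R\<in>Pow A. row_action A R (up v) \<nu>)"
    using row_action_add[OF insert.hyps(1), of _ "up_first v" "up_lower v"]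
    by (simp add: up_def[abs_def] sum.distrib add.commute)
  finally show ?case using insert.IH[of "up v"] insert.hyps bA by (simp add: funpow_swap1)
qed simp

text \<open>This is the sum of \<open>(num_tableaux n \<mu>)\<^sup>2\<close> over the partitions
\<open>\<mu>\<close> of \<open>n\<close> with \<open>k \<le> \<mu> 0\<close>: the power of
\<open>up\<close> runs over the growth paths from the empty partition to
\<open>\<mu>\<close>.\<close>

lemma num_perms_LIS_ge_eq_up_power:
  "of_nat (num_perms_LIS_ge n k) =
     (up ^^ n) (\<lambda>\<mu>. (if k \<le> \<mu> 0 then 1 else 0) * num_tableaux n \<mu>) empty_partition"
proof -
  let ?A = "{1..n}"
  let ?w = "\<lambda>\<sigma>. map \<sigma> [1..<Suc n]"
  let ?S = "{\<sigma>. \<sigma> permutes ?A \<and> LIS n \<sigma> \<ge> k}"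
  let ?T = "{xs. distinct xs \<and> set xs = ?A \<and> k \<le> card (first_row xs)}"
  have "bij_betw ?w ?S ?T"
  proof (rule bij_betw_imageI)
    show "inj_on ?w ?S"
    proof (rule inj_onI)
      fix \<sigma> \<tau> assume s: "\<sigma> \<in> ?S" "\<tau> \<in> ?S" and "?w \<sigma> = ?w \<tau>"
      then have "\<sigma> i = \<tau> i" if "i \<in> ?A" for i using that by (auto simp del: upt_Suc)
      moreover have "\<sigma> i = \<tau> i" if "i \<notin> ?A" for i
        using s that permutes_not_in[of \<sigma> ?A i] permutes_not_in[of \<tau> ?A i] by (simp del: atLeastAtMost_iff)
      ultimately show "\<sigma> = \<tau>" by blast
    qed
    show "?w ` ?S = ?T"
    proof (intro equalityI subsetI)
      fix xs assume "xs \<in> ?w ` ?S"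
      then obtain \<sigma> where \<sigma>: "xs = ?w \<sigma>" "\<sigma> permutes ?A" "LIS n \<sigma> \<ge> k" by blast
      have set: "set [1..<Suc n] = ?A" by (simp add: atLeastLessThanSuc_atLeastAtMost del: upt_Suc)
      have inj: "inj_on \<sigma> ?A" using permutes_inj_on[OF \<sigma>(2)] .
      then have "distinct xs" "set xs = ?A"
        unfolding \<sigma>(1) using permutes_image[OF \<sigma>(2)] set
        by (simp_all add: distinct_map del: upt_Suc)
      then show "xs \<in> ?T" using LIS_eq_card_first_row[OF inj] \<sigma> by simp
    next
      fix xs assume xs: "xs \<in> ?T"
      then have len: "length xs = n" using distinct_card by fastforce
      define \<sigma> where "\<sigma> = (\<lambda>i. if i \<in> ?A then xs ! (i - 1) else i)"
      have w: "?w \<sigma> = xs"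
        by (rule nth_equalityI) (simp_all add: len \<sigma>_def del: upt_Suc)
      have "\<sigma> ` ?A = set (?w \<sigma>)" by (simp add: atLeastLessThanSuc_atLeastAtMost del: upt_Suc)
      then have "\<sigma> ` ?A = set xs" unfolding w .
      then have im: "\<sigma> ` ?A = ?A" using xs by simp
      then have inj: "inj_on \<sigma> ?A" by (simp add: eq_card_imp_inj_on)
      have "\<sigma> permutes ?A"
        by (rule bij_imp_permutes) (use im inj in \<open>auto simp: bij_betw_def \<sigma>_def\<close>)
      moreover have "LIS n \<sigma> \<ge> k" using LIS_eq_card_first_row[OF inj] w xs by simp
      ultimately show "xs \<in> ?w ` ?S" using w by (metis (mono_tags, lifting) image_eqI mem_Collect_eq)
    qed
  qed
  then have "num_perms_LIS_ge n k = card ?T"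
    unfolding num_perms_LIS_ge_def by (rule bij_betw_same_card)
  also have "?T = (\<Union>R\<in>{R\<in>Pow ?A. k \<le> card R}. arrangements ?A R)"
    using first_row_subset by (auto simp: arrangements_def)
  also have "card \<dots> = (\<Sum>R\<in>{R\<in>Pow ?A. k \<le> card R}. card (arrangements ?A R))"
    by (rule card_UN_disjoint) (auto simp: finite_arrangements, auto simp: arrangements_def)
  finally have "of_nat (num_perms_LIS_ge n k) =
      (\<Sum>R\<in>{R\<in>Pow ?A. k \<le> card R}. row_action ?A R (num_tableaux n) empty_partition)"
    by (simp add: card_arrangements_eq_row_action)
  also have "\<dots> = (\<Sum>R\<in>Pow ?A. (if k \<le> card R then 1 else 0) * row_action ?A R (num_tableaux n) empty_partition)"
    by (rule sum.mono_neutral_cong_left) auto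
  also have "\<dots> = (\<Sum>R\<in>Pow ?A. row_action ?A R (\<lambda>\<mu>. (if k \<le> \<mu> 0 then 1 else 0) * num_tableaux n \<mu>) empty_partition)"
    by (intro sum.cong refl)
       (auto simp: row_action_first_row_length[where \<phi> = "\<lambda>l. if k \<le> l then 1 else 0"] Int_absorb2)
  also have "\<dots> = (up ^^ n) (\<lambda>\<mu>. (if k \<le> \<mu> 0 then 1 else 0) * num_tableaux n \<mu>) empty_partition"
    using sum_row_action_subsets[of ?A] by simp
  finally show ?thesis .
qed

section \<open>Alternating functions on tuples\<close>

definition shift :: "nat \<Rightarrow> int \<Rightarrow> (nat \<Rightarrow> int) \<Rightarrow> (nat \<Rightarrow> int)" where
  "shift i a l = l(i := l i + a)"

text \<open>The one-body operator that moves a single variable by \<open>j\<close>, weighted by a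
function of its position.\<close>

definition hop :: "nat \<Rightarrow> nat \<Rightarrow> (int \<Rightarrow> rat) \<Rightarrow> ((nat \<Rightarrow> int) \<Rightarrow> rat) \<Rightarrow> (nat \<Rightarrow> int) \<Rightarrow> rat" where
  "hop N j \<phi> v l = (\<Sum>i<N. \<phi> (l i) * v (shift i (- int j) l))"

definition lower :: "nat \<Rightarrow> ((nat \<Rightarrow> int) \<Rightarrow> rat) \<Rightarrow> (nat \<Rightarrow> int) \<Rightarrow> rat" where
  "lower N v l = (\<Sum>i<N. v (shift i (- 1) l))"

text \<open>The shifts of all the variables by integers commute with each other. The truncation at
the negative tuples destroys this for \<open>raise\<close> and \<open>lower\<close>, and on
alternating functions, at tuples of small sum, the resulting commutator is the identity, as for
adding and removing boxes.\<close>

definition raise :: "nat \<Rightarrow> ((nat \<Rightarrow> int) \<Rightarrow> rat) \<Rightarrow> (nat \<Rightarrow> int) \<Rightarrow> rat" where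
  "raise N v l = (if \<exists>i<N. l i < 0 then 0 else (\<Sum>i<N. v (shift i 1 l)))"

definition alternating :: "nat \<Rightarrow> ((nat \<Rightarrow> int) \<Rightarrow> rat) \<Rightarrow> bool" where
  "alternating N v \<longleftrightarrow>
     (\<forall>l p q. p < N \<longrightarrow> q < N \<longrightarrow> p \<noteq> q \<longrightarrow> v (l \<circ> Transposition.transpose p q) = - v l)"

definition nonneg_supported :: "nat \<Rightarrow> ((nat \<Rightarrow> int) \<Rightarrow> rat) \<Rightarrow> bool" where
  "nonneg_supported N v \<longleftrightarrow> (\<forall>l. (\<exists>i<N. l i < 0) \<longrightarrow> v l = 0)"

definition staircase :: "nat \<Rightarrow> nat \<Rightarrow> int" where
  "staircase N i = int (N - 1 - i)"

text \<open>The alternating function that is \<open>1\<close> at the staircase, which encodes the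
empty partition, and vanishes off the permutations of the staircase.\<close>

definition vacuum :: "nat \<Rightarrow> (nat \<Rightarrow> int) \<Rightarrow> rat" where
  "vacuum N l = (\<Sum>p | p permutes {..<N}. if \<forall>i<N. l i = staircase N (p i) then of_int (sign p) else 0)"

definition fdiff :: "(int \<Rightarrow> rat) \<Rightarrow> int \<Rightarrow> rat" where
  "fdiff \<phi> x = \<phi> (x + 1) - \<phi> x"

definition bdiff :: "(int \<Rightarrow> rat) \<Rightarrow> int \<Rightarrow> rat" where
  "bdiff \<phi> x = \<phi> x - \<phi> (x - 1)"

lemma shift_same [simp]: "shift i a l i = l i + a"
  and shift_other: "k \<noteq> i \<Longrightarrow> shift i a l k = l k"
  by (simp_all add: shift_def)

lemma shift_commute: "shift i a (shift k b l) = shift k b (shift i a l)"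
  by (auto simp: shift_def fun_eq_iff)

lemma shift_shift_same [simp]: "shift i a (shift i b l) = shift i (b + a) l"
  by (auto simp: shift_def fun_eq_iff)

lemma shift_0 [simp]: "shift i 0 l = l"
  by (simp add: shift_def)

lemma shift_transpose:
  "shift i a (l \<circ> Transposition.transpose p q) =
     shift (Transposition.transpose p q i) a l \<circ> Transposition.transpose p q"
  by (auto simp: shift_def fun_eq_iff Transposition.transpose_def)

lemma sum_shift: "i < N \<Longrightarrow> (\<Sum>k<N. shift i a l k) = (\<Sum>k<N. l k) + a"
proof -
  assume "i < N"
  have "(\<Sum>k<N. shift i a l k) = (\<Sum>k<N. l k + (if k = i then a else 0))"
    by (intro sum.cong) (auto simp: shift_def)
  then show ?thesis using \<open>i < N\<close> by (simp add: sum.distrib)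
qed

lemma lower_eq_hop: "lower N = hop N 1 (\<lambda>_. 1)"
  by (auto simp: lower_def hop_def fun_eq_iff)

lemma raise_nonneg: "\<not> (\<exists>i<N. l i < 0) \<Longrightarrow> raise N v l = (\<Sum>i<N. v (shift i 1 l))"
  by (auto simp: raise_def)

lemma raise_neg: "\<exists>i<N. l i < 0 \<Longrightarrow> raise N v l = 0"
  by (auto simp: raise_def)

lemma alternating_repeated:
  assumes "alternating N v" "p < N" "q < N" "p \<noteq> q" "l p = l q"
  shows "v l = 0"
proof -
  have "l \<circ> Transposition.transpose p q = l"
    using assms(5) by (auto simp: fun_eq_iff Transposition.transpose_def)
  then have "v l = - v l" using assms(1-4) unfolding alternating_def by metis
  then show ?thesis by simp
qed

lemma transpose_permutes: "p < N \<Longrightarrow> q < N \<Longrightarrow> Transposition.transpose p q permutes {..<N}"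
  by (rule permutes_swap_id) auto

lemma alternating_hop:
  assumes "alternating N v"
  shows "alternating N (hop N j \<phi> v)"
  unfolding alternating_def
proof safe
  fix l :: "nat \<Rightarrow> int" and p q :: nat assume pq: "p < N" "q < N" "p \<noteq> q"
  let ?t = "Transposition.transpose p q"
  have "hop N j \<phi> v (l \<circ> ?t) = (\<Sum>i<N. \<phi> (l (?t i)) * - v (shift (?t i) (- int j) l))"
    using assms pq unfolding hop_def shift_transpose alternating_def by simp
  also have "\<dots> = (\<Sum>i<N. \<phi> (l i) * - v (shift i (- int j) l))"
    using sum.permute[OF transpose_permutes[OF pq(1,2)], of "\<lambda>i. \<phi> (l i) * - v (shift i (- int j) l)"]
    by (simp add: o_def)
  finally show "hop N j \<phi> v (l \<circ> ?t) = - hop N j \<phi> v l"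
    by (simp add: hop_def sum_negf)
qed

lemma alternating_lower: "alternating N v \<Longrightarrow> alternating N (lower N v)"
  by (simp add: lower_eq_hop alternating_hop)

lemma alternating_raise:
  assumes "alternating N v"
  shows "alternating N (raise N v)"
  unfolding alternating_def
proof safe
  fix l :: "nat \<Rightarrow> int" and p q :: nat assume pq: "p < N" "q < N" "p \<noteq> q"
  let ?t = "Transposition.transpose p q"
  have neg: "(\<exists>i<N. (l \<circ> ?t) i < 0) \<longleftrightarrow> (\<exists>i<N. l i < 0)"
    using pq by (auto simp: Transposition.transpose_def split: if_splits) metis+
  have "(\<Sum>i<N. v (shift i 1 (l \<circ> ?t))) = (\<Sum>i<N. - v (shift (?t i) 1 l))"
    using assms pq unfolding shift_transpose alternating_def by simp
  also have "\<dots> = - (\<Sum>i<N. v (shift i 1 l))"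
    using sum.permute[OF transpose_permutes[OF pq(1,2)], of "\<lambda>i. - v (shift i 1 l)"]
    by (simp add: o_def sum_negf)
  finally show "raise N v (l \<circ> ?t) = - raise N v l"
    using neg raise_neg[of N l] raise_neg[of N "l \<circ> ?t"] raise_nonneg[of N l] raise_nonneg[of N "l \<circ> ?t"]
    by (cases "\<exists>i<N. l i < 0") simp_all
qed

lemma nonneg_supported_hop:
  assumes "nonneg_supported N v"
  shows "nonneg_supported N (hop N j \<phi> v)"
  unfolding nonneg_supported_def
proof safe
  fix l :: "nat \<Rightarrow> int" and i assume i: "i < N" "l i < 0"
  have "v (shift k (- int j) l) = 0" for k
  proof -
    have "shift k (- int j) l i < 0" using i(2) by (auto simp: shift_def)
    then show ?thesis using assms i(1) unfolding nonneg_supported_def by blast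
  qed
  then show "hop N j \<phi> v l = 0" by (simp add: hop_def)
qed

lemma nonneg_supported_lower: "nonneg_supported N v \<Longrightarrow> nonneg_supported N (lower N v)"
  by (simp add: lower_eq_hop nonneg_supported_hop)

lemma nonneg_supported_raise: "nonneg_supported N (raise N v)"
  by (auto simp: nonneg_supported_def raise_def)

lemma alternating_raise_power: "alternating N v \<Longrightarrow> alternating N ((raise N ^^ a) v)"
  by (induction a) (auto intro: alternating_raise)

lemma nonneg_supported_raise_power:
  "nonneg_supported N v \<Longrightarrow> nonneg_supported N ((raise N ^^ a) v)"
  by (cases a) (auto intro: nonneg_supported_raise)

lemma alternating_lower_power: "alternating N v \<Longrightarrow> alternating N ((lower N ^^ a) v)"
  by (induction a) (auto intro: alternating_lower)

lemma nonneg_supported_lower_power: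
  "nonneg_supported N v \<Longrightarrow> nonneg_supported N ((lower N ^^ a) v)"
  by (induction a) (auto intro: nonneg_supported_lower)

lemma alternating_vacuum: "alternating N (vacuum N)"
  unfolding alternating_def
proof safe
  fix l :: "nat \<Rightarrow> int" and p q :: nat assume pq: "p < N" "q < N" "p \<noteq> q"
  let ?t = "Transposition.transpose p q"
  note t = transpose_permutes[OF pq(1,2)]
  have tN: "?t i < N" if "i < N" for i
    using permutes_in_image[OF t, of i] that by simp
  have all: "(\<forall>i<N. (l \<circ> ?t) i = staircase N ((s \<circ> ?t) i)) \<longleftrightarrow> (\<forall>i<N. l i = staircase N (s i))" for s
  proof safe
    fix i assume "\<forall>i<N. (l \<circ> ?t) i = staircase N ((s \<circ> ?t) i)" "i < N"
    then have "(l \<circ> ?t) (?t i) = staircase N ((s \<circ> ?t) (?t i))" using tN by blast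
    then show "l i = staircase N (s i)" by simp
  qed (use tN in simp)
  have sign: "sign (s \<circ> ?t) = - sign s" if "s permutes {..<N}" for s
    using that pq t by (subst sign_compose)
      (auto simp: sign_swap_id intro: permutes_imp_permutation[of "{..<N}"])
  have "vacuum N (l \<circ> ?t) = (\<Sum>s | s permutes {..<N}.
      if \<forall>i<N. (l \<circ> ?t) i = staircase N ((s \<circ> ?t) i) then of_int (sign (s \<circ> ?t)) else 0)"
    unfolding vacuum_def by (rule sum_permutations_compose_right[OF t])
  also have "\<dots> = (\<Sum>s | s permutes {..<N}. - (if \<forall>i<N. l i = staircase N (s i) then of_int (sign s) else 0))"
    unfolding all by (intro sum.cong refl) (auto simp: sign)
  finally show "vacuum N (l \<circ> ?t) = - vacuum N l" by (simp add: vacuum_def sum_negf)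
qed

lemma vacuum_nonzeroE:
  assumes "vacuum N l \<noteq> 0"
  obtains p where "p permutes {..<N}" "\<forall>i<N. l i = staircase N (p i)"
proof -
  have "\<exists>p\<in>{p. p permutes {..<N}}. (if \<forall>i<N. l i = staircase N (p i) then of_int (sign p) else (0::rat)) \<noteq> 0"
    using assms unfolding vacuum_def by (rule contrapos_np) (auto intro: sum.neutral)
  then show ?thesis using that by (auto split: if_splits)
qed

lemma nonneg_supported_vacuum: "nonneg_supported N (vacuum N)"
  unfolding nonneg_supported_def
proof safe
  fix l :: "nat \<Rightarrow> int" and i assume i: "i < N" "l i < 0"
  show "vacuum N l = 0"
  proof (rule ccontr)
    assume "vacuum N l \<noteq> 0"
    then obtain p where "\<forall>i<N. l i = staircase N (p i)" by (rule vacuum_nonzeroE)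
    then show False using i by (auto simp: staircase_def)
  qed
qed

lemma vacuum_staircase: "vacuum N (staircase N) = 1"
proof -
  have id: "(\<forall>i<N. staircase N i = staircase N (p i)) \<longleftrightarrow> p = id" if "p permutes {..<N}" for p
  proof
    assume *: "\<forall>i<N. staircase N i = staircase N (p i)"
    show "p = id"
    proof
      fix i show "p i = id i"
      proof (cases "i < N")
        case True
        then have "p i < N" using permutes_in_image[OF that, of i] by simp
        then show ?thesis using True * by (auto simp: staircase_def)
      qed (use permutes_not_in[OF that] in auto)
    qed
  qed auto
  have "vacuum N (staircase N) = (\<Sum>p | p permutes {..<N}. if p = id then 1 else 0)"
    unfolding vacuum_def by (intro sum.cong refl) (auto simp: id)
  then show ?thesis by (simp add: permutes_id finite_permutations)
qed

text \<open>A nonnegative tuple that becomes a permutation of the staircase by raising one entry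
has a repeated entry.\<close>

lemma raise_vacuum: "raise N (vacuum N) = (\<lambda>_. 0)"
proof
  fix l
  show "raise N (vacuum N) l = 0"
  proof (cases "\<exists>i<N. l i < 0")
    case False
    show ?thesis
    proof (cases "\<exists>i<N. vacuum N (shift i 1 l) \<noteq> 0")
      case True
      then obtain i where i: "i < N" "vacuum N (shift i 1 l) \<noteq> 0" by blast
      then obtain p where p: "p permutes {..<N}" "\<forall>k<N. shift i 1 l k = staircase N (p k)"
        by (auto elim: vacuum_nonzeroE)
      have li: "l i = staircase N (p i) - 1" using p(2) i(1) by (metis add_diff_cancel_right' shift_same)
      have "p i < N" using p(1) i(1) permutes_in_image by fastforce
      have "0 \<le> l i" using False i(1) by force
      then have "Suc (p i) < N" using li by (auto simp: staircase_def)
      then have "Suc (p i) \<in> p ` {..<N}" using permutes_image[OF p(1)] by simp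
      then obtain k where k: "k < N" "p k = Suc (p i)" by auto
      then have ki: "k \<noteq> i" by auto
      have "l k = l i"
        using p(2) k ki li \<open>Suc (p i) < N\<close> by (auto simp: shift_other staircase_def)
      then show ?thesis
        using alternating_repeated[OF alternating_raise[OF alternating_vacuum] k(1) i(1) ki] by simp
    qed (simp add: raise_def)
  qed (simp add: raise_def)
qed

text \<open>Lowering an entry of the staircase produces a repeated entry or the entry \<open>-
1\<close>.\<close>

lemma lower_staircase:
  assumes "alternating N w" "nonneg_supported N w"
  shows "lower N w (staircase N) = 0"
  unfolding lower_def
proof (intro sum.neutral ballI)
  fix i assume i: "i \<in> {..<N}"
  let ?l = "shift i (- 1) (staircase N)"
  show "w ?l = 0"
  proof (cases "Suc i < N")
    case True
    then have "?l i = ?l (Suc i)" by (auto simp: shift_def staircase_def)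
    then show ?thesis using alternating_repeated[OF assms(1), of i "Suc i" ?l] True by simp
  next
    case False
    then have "?l i < 0" using i by (simp add: staircase_def)
    then show ?thesis using assms(2) i unfolding nonneg_supported_def by blast
  qed
qed

lemma sum_lessThan_card_le:
  assumes "finite (A :: nat set)"
  shows "\<Sum>{..<card A} \<le> \<Sum>A"
  using assms
proof (induction A rule: finite_linorder_max_induct)
  case (insert b A)
  have "A \<subseteq> {..<b}" using insert.hyps(2) by auto
  then have "card A \<le> b" using card_mono[of "{..<b}" A] by simp
  moreover have "b \<notin> A" using insert.hyps(2) by auto
  ultimately show ?case using insert by simp
qed simp

text \<open>A tuple of small sum with distinct nonnegative entries contains the entry
\<open>0\<close> exactly once; at a repeated entry \<open>v\<close> vanishes.\<close>

lemma card_zeros: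
  assumes "alternating N v" "\<forall>i<N. 0 \<le> l i" "(\<Sum>i<N. l i) < int (\<Sum>{..<N}) + int N"
  shows "of_nat (card {i. i < N \<and> l i = 0}) * v l = v l"
proof (cases "v l = 0")
  case False
  then have inj: "inj_on l {..<N}"
    using alternating_repeated[OF assms(1)] by (force simp: inj_on_def)
  have "\<exists>i<N. l i = 0"
  proof (rule ccontr)
    assume no: "\<not> (\<exists>i<N. l i = 0)"
    then have pos: "1 \<le> l i" if "i < N" for i using assms(2) that by force
    let ?g = "\<lambda>i. nat (l i - 1)"
    have inj': "inj_on ?g {..<N}"
    proof (rule inj_onI)
      fix i k assume ik: "i \<in> {..<N}" "k \<in> {..<N}" "?g i = ?g k"
      then have "l i = l k" using pos[of i] pos[of k] by simp
      then show "i = k" using inj ik by (simp add: inj_on_def)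
    qed
    have "\<Sum>{..<card (?g ` {..<N})} \<le> \<Sum>(?g ` {..<N})"
      by (rule sum_lessThan_card_le) simp
    then have "\<Sum>{..<N} \<le> (\<Sum>i<N. ?g i)"
      using inj' by (simp add: card_image sum.reindex)
    then have "int (\<Sum>{..<N}) \<le> int (\<Sum>i<N. ?g i)" by (simp only: of_nat_le_iff)
    also have "\<dots> = (\<Sum>i<N. int (?g i))" by (rule of_nat_sum)
    also have "\<dots> = (\<Sum>i<N. l i - 1)" by (intro sum.cong refl) (auto dest!: pos)
    finally show False using assms(3) by (simp add: sum_subtractf)
  qed
  then obtain i where "i < N" "l i = 0" by blast
  then have "{k. k < N \<and> l k = 0} = {i}" using inj by (auto simp: inj_on_def)
  then show ?thesis by simp
qed simp

text \<open>The double sums agree except where lowering would create a negative entry: there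
\<open>raise\<close> has lost the term that moves a zero down and up again. By
\<open>card_zeros\<close> there is one such term.\<close>

lemma raise_lower:
  assumes alt: "alternating N v" and supp: "nonneg_supported N v"
    and small: "(\<Sum>i<N. l i) < int (\<Sum>{..<N}) + int N"
  shows "raise N (lower N v) l = lower N (raise N v) l + v l"
proof (cases "\<exists>i<N. l i < 0")
  case True
  then show ?thesis
    using supp nonneg_supported_raise[of N "lower N v"]
      nonneg_supported_lower[OF nonneg_supported_raise[of N v]]
    unfolding nonneg_supported_def by simp
next
  case False
  have inner: "(\<Sum>i<N. v (shift k (- 1) (shift i 1 l))) =
      raise N v (shift k (- 1) l) + (if l k = 0 then v l else 0)" if k: "k < N" for k
  proof (cases "l k = 0")
    case True
    have "(\<Sum>i<N. v (shift k (- 1) (shift i 1 l))) = (\<Sum>i<N. if i = k then v l else 0)"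
    proof (rule sum.cong[OF refl])
      fix i
      show "v (shift k (- 1) (shift i 1 l)) = (if i = k then v l else 0)"
      proof (cases "i = k")
        case False
        then have "shift k (- 1) (shift i 1 l) k < 0" using True by (simp add: shift_other)
        then have "v (shift k (- 1) (shift i 1 l)) = 0"
          using supp k unfolding nonneg_supported_def by blast
        then show ?thesis using False by simp
      qed simp
    qed
    moreover have "raise N v (shift k (- 1) l) = 0"
      using True k by (auto simp: raise_def intro!: exI[of _ k])
    ultimately show ?thesis using True k by simp
  next
    case nz: False
    then have "0 < l k" using False k by force
    then have "\<not> (\<exists>i<N. shift k (- 1) l i < 0)"
      using False by (auto simp: shift_def)
    then show ?thesis using nz by (simp add: raise_nonneg shift_commute[of k])
  qed
  have "raise N (lower N v) l = (\<Sum>i<N. \<Sum>k<N. v (shift k (- 1) (shift i 1 l)))"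
    using raise_nonneg[OF False] by (simp add: lower_def)
  also have "\<dots> = (\<Sum>k<N. \<Sum>i<N. v (shift k (- 1) (shift i 1 l)))" by (rule sum.swap)
  also have "\<dots> = lower N (raise N v) l + (\<Sum>k<N. if l k = 0 then v l else 0)"
    by (simp add: inner sum.distrib lower_def)
  also have "(\<Sum>k<N. if l k = 0 then v l else 0) = of_nat (card {i. i < N \<and> l i = 0}) * v l"
    by (simp add: sum.If_cases lessThan_def Collect_conj_eq)
  finally show ?thesis using card_zeros[OF alt _ small] False by force
qed

lemma raise_add: "raise N (\<lambda>l. v l + w l) = (\<lambda>l. raise N v l + raise N w l)"
  by (auto simp: raise_def fun_eq_iff sum.distrib)

lemma raise_power_add: "(raise N ^^ a) (\<lambda>l. v l + w l) = (\<lambda>l. (raise N ^^ a) v l + (raise N ^^ a) w l)"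
  by (induction a) (simp_all add: raise_add)

lemma raise_power_lower:
  assumes alt: "alternating N v" and supp: "nonneg_supported N v"
    and small: "(\<Sum>i<N. l i) + int a \<le> int (\<Sum>{..<N}) + int N"
  shows "(raise N ^^ a) (lower N v) l = lower N ((raise N ^^ a) v) l + of_nat a * (raise N ^^ (a - 1)) v l"
  using small
proof (induction a arbitrary: l)
  case (Suc a)
  show ?case
  proof (cases "\<exists>i<N. l i < 0")
    case True
    then show ?thesis
      using nonneg_supported_raise_power[OF supp, of a] nonneg_supported_raise[of N]
        nonneg_supported_lower[OF nonneg_supported_raise[of N]]
      unfolding nonneg_supported_def by simp
  next
    case False
    let ?w = "(raise N ^^ a) v"
    have "(raise N ^^ Suc a) (lower N v) l = (\<Sum>i<N. (raise N ^^ a) (lower N v) (shift i 1 l))"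
      using raise_nonneg[OF False] by simp
    also have "\<dots> = (\<Sum>i<N. lower N ?w (shift i 1 l) + of_nat a * (raise N ^^ (a - 1)) v (shift i 1 l))"
      using Suc.prems by (intro sum.cong refl Suc.IH) (simp add: sum_shift)
    also have "\<dots> = raise N (lower N ?w) l + of_nat a * raise N ((raise N ^^ (a - 1)) v) l"
      unfolding raise_nonneg[OF False] by (simp add: sum.distrib sum_distrib_left)
    also have "of_nat a * raise N ((raise N ^^ (a - 1)) v) l = of_nat a * ?w l"
      by (cases a) simp_all
    also have "raise N (lower N ?w) l = lower N (raise N ?w) l + ?w l"
      using Suc.prems by (intro raise_lower alternating_raise_power nonneg_supported_raise_power alt supp) simp
    finally show ?thesis by (simp add: algebra_simps)
  qed
qed simp

text \<open>Only the terms in which the same variable is moved twice contribute to the commutator,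
and the two positions at which the weight is taken differ by one.\<close>

lemma hop_lower:
  "hop N j \<phi> (lower N v) l = lower N (hop N j \<phi> v) l + hop N (Suc j) (bdiff \<phi>) v l"
proof -
  let ?a = "\<lambda>i k. \<phi> (l i) * v (shift k (- 1) (shift i (- int j) l))"
  let ?b = "\<lambda>i k. \<phi> (shift k (- 1) l i) * v (shift i (- int j) (shift k (- 1) l))"
  have ab: "?a i k - ?b i k = (if k = i then bdiff \<phi> (l i) * v (shift i (- int (Suc j)) l) else 0)" for i k
  proof (cases "k = i")
    case True
    then show ?thesis by (simp add: bdiff_def algebra_simps)
  next
    case False
    then show ?thesis by (simp add: shift_other shift_commute[of k])
  qed
  have "hop N j \<phi> (lower N v) l - lower N (hop N j \<phi> v) l = (\<Sum>i<N. \<Sum>k<N. ?a i k) - (\<Sum>k<N. \<Sum>i<N. ?b i k)"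
    by (simp add: hop_def lower_def sum_distrib_left)
  also have "(\<Sum>k<N. \<Sum>i<N. ?b i k) = (\<Sum>i<N. \<Sum>k<N. ?b i k)" by (rule sum.swap)
  also have "(\<Sum>i<N. \<Sum>k<N. ?a i k) - \<dots> = (\<Sum>i<N. \<Sum>k<N. ?a i k - ?b i k)"
    by (simp add: sum_subtractf)
  also have "\<dots> = hop N (Suc j) (bdiff \<phi>) v l" unfolding ab by (simp add: hop_def)
  finally show ?thesis by simp
qed

text \<open>As in \<open>hop_lower\<close>. The hypothesis on \<open>\<psi>\<close> keeps the
moved variable away from the truncation.\<close>

lemma raise_hop:
  assumes supp: "nonneg_supported N v" and \<psi>: "\<And>x. x < int (Suc j) \<Longrightarrow> \<psi> x = 0"
  shows "raise N (hop N (Suc j) \<psi> v) l = hop N (Suc j) \<psi> (raise N v) l + hop N j (fdiff \<psi>) v l"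
proof (cases "\<exists>i<N. l i < 0")
  case True
  then show ?thesis
    using nonneg_supported_raise[of N "hop N (Suc j) \<psi> v"] nonneg_supported_hop[OF supp, of j]
      nonneg_supported_hop[OF nonneg_supported_raise[of N v], of "Suc j"]
    unfolding nonneg_supported_def by simp
next
  case False
  let ?a = "\<lambda>i k. \<psi> (l i) * v (shift k 1 (shift i (- int (Suc j)) l))"
  let ?b = "\<lambda>i k. \<psi> (shift k 1 l i) * v (shift i (- int (Suc j)) (shift k 1 l))"
  have ab: "?b i k - ?a i k = (if k = i then fdiff \<psi> (l i) * v (shift i (- int j) l) else 0)" for i k
  proof (cases "k = i")
    case True
    then show ?thesis by (simp add: fdiff_def algebra_simps)
  next
    case False
    then show ?thesis by (simp add: shift_other shift_commute[of k])
  qed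
  have cut: "\<psi> (l i) * raise N v (shift i (- int (Suc j)) l) = (\<Sum>k<N. ?a i k)" if "i < N" for i
  proof (cases "l i < int (Suc j)")
    case True
    then show ?thesis using \<psi> by simp
  next
    case ge: False
    then have "\<not> (\<exists>k<N. shift i (- int (Suc j)) l k < 0)"
      using False by (auto simp: shift_def)
    then show ?thesis using raise_nonneg by (simp add: sum_distrib_left)
  qed
  have "raise N (hop N (Suc j) \<psi> v) l - hop N (Suc j) \<psi> (raise N v) l =
      (\<Sum>k<N. \<Sum>i<N. ?b i k) - (\<Sum>i<N. \<Sum>k<N. ?a i k)"
    unfolding raise_nonneg[OF False] hop_def by (simp add: cut del: of_nat_Suc)
  also have "(\<Sum>k<N. \<Sum>i<N. ?b i k) = (\<Sum>i<N. \<Sum>k<N. ?b i k)" by (rule sum.swap)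
  also have "\<dots> - (\<Sum>i<N. \<Sum>k<N. ?a i k) = (\<Sum>i<N. \<Sum>k<N. ?b i k - ?a i k)"
    by (simp add: sum_subtractf)
  also have "\<dots> = hop N j (fdiff \<psi>) v l" unfolding ab by (simp add: hop_def)
  finally show ?thesis by simp
qed

text \<open>As \<open>raise\<close> annihilates the vacuum, every \<open>raise\<close> is used up
by its commutator with \<open>hop\<close>, which replaces \<open>\<psi>\<close> by its forward
difference and shortens the move by one.\<close>

lemma raise_power_hop_vacuum:
  assumes "\<And>x. x < int a \<Longrightarrow> \<psi> x = 0"
  shows "(raise N ^^ a) (hop N a \<psi> (vacuum N)) (staircase N) = (\<Sum>x<N. (fdiff ^^ a) \<psi> (int x))"
  using assms
proof (induction a arbitrary: \<psi>)
  case 0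
  have "hop N 0 \<psi> (vacuum N) (staircase N) = (\<Sum>i<N. \<psi> (int (N - 1 - i)))"
    by (simp add: hop_def vacuum_staircase) (simp add: staircase_def)
  also have "\<dots> = (\<Sum>x<N. \<psi> (int x))"
    using sum.nat_diff_reindex[of "\<lambda>x. \<psi> (int x)" N] by simp
  finally show ?case by simp
next
  case (Suc a)
  have "raise N (hop N (Suc a) \<psi> (vacuum N)) = hop N a (fdiff \<psi>) (vacuum N)"
  proof
    fix l :: "nat \<Rightarrow> int"
    have "hop N (Suc a) \<psi> (\<lambda>_. 0) l = 0" by (simp add: hop_def)
    then show "raise N (hop N (Suc a) \<psi> (vacuum N)) l = hop N a (fdiff \<psi>) (vacuum N) l"
      using raise_hop[OF nonneg_supported_vacuum Suc.prems, where l = l] by (simp add: raise_vacuum)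
  qed
  moreover have "fdiff \<psi> x = 0" if "x < int a" for x
    using Suc.prems[of x] Suc.prems[of "x + 1"] that by (simp add: fdiff_def)
  ultimately show ?case using Suc.IH[of "fdiff \<psi>"] by (simp add: funpow_swap1)
qed

text \<open>Writing \<open>Q a b j \<phi>\<close> for the left-hand side, \<open>hop_lower\<close>
and \<open>raise_power_lower\<close> give \<open>Q a (b + 1) j \<phi> = Q (a - 1) b j \<phi> + Q a
b (j + 1) (bdiff \<phi>)\<close>, because a final lowering at the staircase vanishes. The division
by \<open>fact a\<close> removes the factor \<open>a\<close> and makes this the recursion of
Pascal.\<close>

lemma raise_power_hop_lower_power:
  assumes "b \<le> a" "a \<le> N"
  shows "(raise N ^^ a) (hop N j \<phi> ((lower N ^^ b) (vacuum N))) (staircase N) / fact a =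
    (\<Sum>i\<le>b. of_nat (b choose i) *
       ((raise N ^^ (a - b + i)) (hop N (j + i) ((bdiff ^^ i) \<phi>) (vacuum N)) (staircase N) / fact (a - b + i)))"
  using assms
proof (induction b arbitrary: a j \<phi>)
  case 0
  then show ?case by simp
next
  case (Suc b)
  let ?v = "(lower N ^^ b) (vacuum N)"
  define T where "T = (\<lambda>i. (raise N ^^ (a - Suc b + i)) (hop N (j + i) ((bdiff ^^ i) \<phi>) (vacuum N))
      (staircase N) / fact (a - Suc b + i))"
  obtain a' where a': "a = Suc a'" using Suc.prems by (cases a) auto
  have alt: "alternating N ?v" and supp: "nonneg_supported N ?v"
    by (simp_all add: alternating_lower_power alternating_vacuum nonneg_supported_lower_power
        nonneg_supported_vacuum)
  have sum_stair: "(\<Sum>i<N. staircase N i) = int (\<Sum>{..<N})"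
    using sum.nat_diff_reindex[of "\<lambda>x. int x" N] by (simp add: staircase_def)
  have "(raise N ^^ a) (lower N (hop N j \<phi> ?v)) (staircase N) =
      of_nat a * (raise N ^^ a') (hop N j \<phi> ?v) (staircase N)"
    using Suc.prems a' raise_power_lower[OF alternating_hop[OF alt] nonneg_supported_hop[OF supp],
        of "staircase N" a]
    by (simp add: sum_stair lower_staircase alternating_raise_power nonneg_supported_raise_power
        alternating_raise nonneg_supported_raise alternating_hop alt)
  moreover have "hop N j \<phi> (lower N ?v) = (\<lambda>l. lower N (hop N j \<phi> ?v) l + hop N (Suc j) (bdiff \<phi>) ?v l)"
    using hop_lower by blast
  moreover have "(lower N ^^ Suc b) (vacuum N) = lower N ?v" by simp
  ultimately have "(raise N ^^ a) (hop N j \<phi> ((lower N ^^ Suc b) (vacuum N))) (staircase N) =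
      of_nat a * (raise N ^^ a') (hop N j \<phi> ?v) (staircase N) +
      (raise N ^^ a) (hop N (Suc j) (bdiff \<phi>) ?v) (staircase N)"
    by (simp only: raise_power_add)
  moreover have "(of_nat a * x + y) / fact a = x / fact a' + y / fact a" for x y :: rat
    unfolding a' fact_Suc add_divide_distrib by simp
  ultimately have "(raise N ^^ a) (hop N j \<phi> ((lower N ^^ Suc b) (vacuum N))) (staircase N) / fact a =
      (raise N ^^ a') (hop N j \<phi> ?v) (staircase N) / fact a' +
      (raise N ^^ a) (hop N (Suc j) (bdiff \<phi>) ?v) (staircase N) / fact a"
    by (simp only:)
  also have "(raise N ^^ a') (hop N j \<phi> ?v) (staircase N) / fact a' = (\<Sum>i\<le>b. of_nat (b choose i) * T i)"
    using Suc.IH[of a' j \<phi>] Suc.prems a' by (simp add: T_def)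
  also have "(raise N ^^ a) (hop N (Suc j) (bdiff \<phi>) ?v) (staircase N) / fact a =
      (\<Sum>i\<le>b. of_nat (b choose i) * T (Suc i))"
    using Suc.IH[of a "Suc j" "bdiff \<phi>"] Suc.prems
    by (simp add: T_def funpow_swap1 a' Suc_diff_le)
  also have "(\<Sum>i\<le>b. of_nat (b choose i) * T i) + (\<Sum>i\<le>b. of_nat (b choose i) * T (Suc i)) =
      (\<Sum>i\<le>Suc b. of_nat (Suc b choose i) * T i)"
  proof -
    have "(\<Sum>i\<le>b. of_nat (b choose i) * T i) = (\<Sum>i\<le>Suc b. of_nat (b choose i) * T i)"
      by simp
    also have "\<dots> = T 0 + (\<Sum>i\<le>b. of_nat (b choose Suc i) * T (Suc i))"
      by (subst sum.atMost_Suc_shift) simp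
    finally show ?thesis
      by (subst sum.atMost_Suc_shift) (simp add: sum.distrib algebra_simps)
  qed
  finally show ?case by (simp add: T_def)
qed

lemma bdiff_power_vanishes:
  "(\<And>x. x < c \<Longrightarrow> \<phi> x = 0) \<Longrightarrow> x < c \<Longrightarrow> (bdiff ^^ i) \<phi> x = 0"
  by (induction i arbitrary: x) (simp_all add: bdiff_def)

lemma raise_power_one_body_lower_power:
  assumes "n \<le> N" "\<And>x. x < int n \<Longrightarrow> \<phi> x = 0"
  shows "(raise N ^^ n) (\<lambda>l. (\<Sum>i<N. \<phi> (l i)) * (lower N ^^ n) (vacuum N) l) (staircase N) =
    fact n * (\<Sum>j\<le>n. of_nat (n choose j) / fact j * (\<Sum>x<N. (fdiff ^^ j) ((bdiff ^^ j) \<phi>) (int x)))"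
proof -
  have "(\<lambda>l. (\<Sum>i<N. \<phi> (l i)) * (lower N ^^ n) (vacuum N) l) = hop N 0 \<phi> ((lower N ^^ n) (vacuum N))"
    by (simp add: hop_def sum_distrib_right fun_eq_iff)
  moreover have "(raise N ^^ j) (hop N j ((bdiff ^^ j) \<phi>) (vacuum N)) (staircase N) =
      (\<Sum>x<N. (fdiff ^^ j) ((bdiff ^^ j) \<phi>) (int x))" if "j \<le> n" for j
    using that assms(2) by (intro raise_power_hop_vacuum bdiff_power_vanishes) auto
  ultimately show ?thesis
    using raise_power_hop_lower_power[of n n N 0 \<phi>] assms(1) by (simp add: field_simps)
qed

section \<open>A single-sum formula\<close>

definition shifted_parts :: "nat \<Rightarrow> (nat \<Rightarrow> nat) \<Rightarrow> (nat \<Rightarrow> int)" where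
  "shifted_parts N \<mu> i = int (\<mu> i) + staircase N i"

text \<open>A tuple of \<open>N\<close> variables has no room for an additional row, so the number
of rows is bounded by \<open>s\<close>; each application of \<open>up\<close> costs one unit of
this bound.\<close>

definition represents ::
    "nat \<Rightarrow> nat \<Rightarrow> ((nat \<Rightarrow> int) \<Rightarrow> rat) \<Rightarrow> ((nat \<Rightarrow> nat) \<Rightarrow> rat) \<Rightarrow> bool" where
  "represents N s w v \<longleftrightarrow>
     (\<forall>\<mu>\<in>partitions. (\<forall>i\<ge>s. \<mu> i = 0) \<longrightarrow> v \<mu> = w (shifted_parts N \<mu>))"

lemma shifted_parts_empty: "shifted_parts N empty_partition = staircase N"
  by (simp add: shifted_parts_def fun_eq_iff)

lemma shifted_parts_nonneg: "\<not> (\<exists>i<N. shifted_parts N \<mu> i < 0)"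
  by (simp add: shifted_parts_def staircase_def not_less)

lemma shift_shifted_parts_add: "shift i 1 (shifted_parts N \<mu>) = shifted_parts N (add_box i \<mu>)"
  by (auto simp: shift_def shifted_parts_def add_box_def fun_eq_iff)

lemma shift_shifted_parts_del:
  "i \<in> descents \<mu> \<Longrightarrow> shift i (- 1) (shifted_parts N \<mu>) = shifted_parts N (del_box i \<mu>)"
  by (auto simp: shift_def shifted_parts_def del_box_def descents_def fun_eq_iff)

lemma down_eq_sum_descents:
  assumes "\<mu> \<in> partitions"
  shows "down v \<mu> = (\<Sum>i\<in>descents \<mu>. v (del_box i \<mu>))"
proof -
  let ?L = "{i. Suc i \<in> descents \<mu>}"
  have D: "descents \<mu> = (if 0 \<in> descents \<mu> then {0} else {}) \<union> Suc ` ?L"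
    by (auto simp: image_iff) (metis not0_implies_Suc)+
  have "(\<Sum>i\<in>descents \<mu>. v (del_box i \<mu>)) =
      (\<Sum>i\<in>(if 0 \<in> descents \<mu> then {0} else {}). v (del_box i \<mu>)) + (\<Sum>i\<in>Suc ` ?L. v (del_box i \<mu>))"
    by (subst D, rule sum.union_disjoint) (use finite_lower_descents[OF assms] in auto)
  then show ?thesis by (simp add: down_def down_first_def down_lower_def sum.reindex)
qed

text \<open>A row from which no box can be removed yields a tuple with a repeated or negative
entry.\<close>

lemma represents_lower:
  assumes "represents N N w v" "alternating N w" "nonneg_supported N w"
  shows "represents N N (lower N w) (down v)"
  unfolding represents_def
proof safe
  fix \<mu> assume \<mu>: "\<mu> \<in> partitions" and zero: "\<forall>i\<ge>N. \<mu> i = 0"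
  let ?l = "shifted_parts N \<mu>"
  have mono: "\<mu> (Suc i) \<le> \<mu> i" for i using \<mu> by (simp add: partitions_iff)
  have sub: "descents \<mu> \<subseteq> {..<N}" using zero by (force simp: descents_def not_less[symmetric])
  have zero_term: "w (shift i (- 1) ?l) = 0" if i: "i \<in> {..<N} - descents \<mu>" for i
  proof -
    have eq: "\<mu> (Suc i) = \<mu> i" using i mono[of i] by (auto simp: descents_def)
    show ?thesis
    proof (cases "Suc i < N")
      case True
      then have "shift i (- 1) ?l i = shift i (- 1) ?l (Suc i)"
        using eq by (simp add: shift_def shifted_parts_def staircase_def)
      then show ?thesis using alternating_repeated[OF assms(2), of i "Suc i"] True by simp
    next
      case False
      then have "shift i (- 1) ?l i < 0"
        using eq zero i by (simp add: shifted_parts_def staircase_def)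
      then show ?thesis using assms(3) i unfolding nonneg_supported_def by blast
    qed
  qed
  have "lower N w ?l = (\<Sum>i\<in>descents \<mu>. w (shift i (- 1) ?l))"
    unfolding lower_def by (rule sum.mono_neutral_right) (use sub zero_term in auto)
  also have "\<dots> = (\<Sum>i\<in>descents \<mu>. v (del_box i \<mu>))"
  proof (rule sum.cong[OF refl])
    fix i assume i: "i \<in> descents \<mu>"
    have "\<forall>j\<ge>N. del_box i \<mu> j = 0" using zero by (simp add: del_box_def)
    then show "w (shift i (- 1) ?l) = v (del_box i \<mu>)"
      using assms(1) del_box_partition[OF \<mu> i] by (simp add: represents_def shift_shifted_parts_del[OF i])
  qed
  finally show "down v \<mu> = lower N w ?l" using down_eq_sum_descents[OF \<mu>] by simp
qed

lemma represents_raise: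
  assumes "represents N (Suc s) w v" "alternating N w" "s < N"
  shows "represents N s (raise N w) (up v)"
  unfolding represents_def
proof safe
  fix \<mu> assume \<mu>: "\<mu> \<in> partitions" and zero: "\<forall>i\<ge>s. \<mu> i = 0"
  let ?l = "shifted_parts N \<mu>" and ?S = "insert 0 (Suc ` descents \<mu>)"
  have mono: "\<mu> (Suc i) \<le> \<mu> i" for i using \<mu> by (simp add: partitions_iff)
  have le_s: "i \<le> s" if "i \<in> ?S" for i
    using that zero by (force simp: descents_def not_less_eq_eq[symmetric])
  have sub: "?S \<subseteq> {..<N}"
    using le_s assms(3) by (meson lessThan_iff le_less_trans subsetI)
  have zero_term: "w (shift i 1 ?l) = 0" if i: "i \<in> {..<N} - ?S" for i
  proof -
    obtain j where j: "i = Suc j" using i by (cases i) auto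
    then have "\<mu> (Suc j) = \<mu> j" using i mono[of j] by (auto simp: descents_def)
    then have "shift i 1 ?l i = shift i 1 ?l j"
      using i j by (simp add: shift_def shifted_parts_def staircase_def)
    then show ?thesis using alternating_repeated[OF assms(2), of i j] i j by simp
  qed
  have "raise N w ?l = (\<Sum>i<N. w (shift i 1 ?l))"
    by (rule raise_nonneg[OF shifted_parts_nonneg])
  also have "\<dots> = (\<Sum>i\<in>?S. w (shift i 1 ?l))"
    by (rule sum.mono_neutral_right) (use sub zero_term in auto)
  also have "\<dots> = (\<Sum>i\<in>?S. v (add_box i \<mu>))"
  proof (rule sum.cong[OF refl])
    fix i assume i: "i \<in> ?S"
    have "add_box i \<mu> \<in> partitions"
      using i \<mu> add_box_0_partition add_box_Suc_partition by blast
    moreover have "\<forall>j\<ge>Suc s. add_box i \<mu> j = 0"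
      using zero le_s[OF i] by (simp add: add_box_def)
    ultimately show "w (shift i 1 ?l) = v (add_box i \<mu>)"
      using assms(1) by (simp add: represents_def shift_shifted_parts_add)
  qed
  also have "\<dots> = up v \<mu>"
    using finite_descents[OF \<mu>] by (simp add: up_def up_first_def up_lower_def sum.reindex)
  finally show "up v \<mu> = raise N w ?l" by simp
qed

lemma represents_raise_power:
  assumes "represents N N w v" "alternating N w" "m \<le> N"
  shows "represents N (N - m) ((raise N ^^ m) w) ((up ^^ m) v)"
  using assms(3)
proof (induction m)
  case (Suc m)
  then have "Suc (N - Suc m) = N - m" by simp
  then show ?case
    using Suc represents_raise[of N "N - Suc m", OF _ alternating_raise_power[OF assms(2), of m]]
    by simp
qed (simp add: assms(1))

lemma represents_num_tableaux:
  "represents N N ((lower N ^^ m) (vacuum N)) (num_tableaux m)"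
proof (induction m)
  case 0
  show ?case unfolding represents_def
  proof safe
    fix \<mu> assume \<mu>: "\<mu> \<in> partitions" and zero: "\<forall>i\<ge>N. \<mu> i = 0"
    show "num_tableaux 0 \<mu> = (lower N ^^ 0) (vacuum N) (shifted_parts N \<mu>)"
    proof (cases "\<mu> = empty_partition")
      case True
      then show ?thesis by (simp add: shifted_parts_empty vacuum_staircase)
    next
      case False
      then obtain i where i: "\<mu> i \<noteq> 0" by (auto simp: fun_eq_iff)
      then have "0 < N" using zero by (metis not_gr_zero le0)
      have "\<mu> i \<le> \<mu> 0" using \<mu> by (auto simp: partitions_def antimono_def)
      then have big: "int N \<le> shifted_parts N \<mu> 0"
        using i \<open>0 < N\<close> by (simp add: shifted_parts_def staircase_def)
      have "vacuum N (shifted_parts N \<mu>) = 0"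
      proof (rule ccontr)
        assume "vacuum N (shifted_parts N \<mu>) \<noteq> 0"
        then obtain p where "\<forall>i<N. shifted_parts N \<mu> i = staircase N (p i)" by (rule vacuum_nonzeroE)
        then have "shifted_parts N \<mu> 0 = staircase N (p 0)" using \<open>0 < N\<close> by blast
        then show False using big \<open>0 < N\<close> by (simp add: staircase_def)
      qed
      then show ?thesis using False by simp
    qed
  qed
next
  case (Suc m)
  then show ?case
    by (simp add: represents_lower alternating_lower_power alternating_vacuum
        nonneg_supported_lower_power nonneg_supported_vacuum)
qed

lemma num_tableaux_nonzero:
  assumes "\<mu> \<in> partitions" "num_tableaux m \<mu> \<noteq> 0"
  shows "\<mu> 0 + \<mu> 1 \<le> m"
  using assms
proof (induction m arbitrary: \<mu>)
  case 0
  then show ?case by (simp split: if_splits)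
next
  case (Suc m)
  have "(\<Sum>i\<in>descents \<mu>. num_tableaux m (del_box i \<mu>)) \<noteq> 0"
    using Suc.prems(2) by (simp add: down_eq_sum_descents[OF Suc.prems(1)])
  then obtain i where i: "i \<in> descents \<mu>" "num_tableaux m (del_box i \<mu>) \<noteq> 0"
    by (meson sum.neutral)
  have "del_box i \<mu> 0 + del_box i \<mu> 1 \<le> m"
    using Suc.IH[OF del_box_partition[OF Suc.prems(1) i(1)] i(2)] .
  then show ?case by (auto simp: del_box_def split: if_splits)
qed

definition signed_binomial :: "nat \<Rightarrow> int \<Rightarrow> rat" where
  "signed_binomial m d = (if d < 0 then 0 else (- 1) ^ nat d * of_nat (m choose nat d))"

lemma signed_binomial_Suc:
  "signed_binomial (Suc m) d = signed_binomial m d - signed_binomial m (d - 1)"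
proof (cases "d \<le> 0")
  case True
  then show ?thesis by (cases "d = 0") (auto simp: signed_binomial_def)
next
  case False
  define e where "e = nat (d - 1)"
  have "d = int (Suc e)" using False by (simp add: e_def)
  then show ?thesis by (simp add: signed_binomial_def nat_add_distrib algebra_simps)
qed

lemma fdiff_bdiff_power_indicator:
  "(fdiff ^^ a) ((bdiff ^^ b) (\<lambda>x. if x = K then 1 else 0)) x = signed_binomial (a + b) (x - K + int a)"
proof (induction a arbitrary: x)
  case 0
  have "(bdiff ^^ b) (\<lambda>x. if x = K then 1 else 0) x = signed_binomial b (x - K)"
  proof (induction b arbitrary: x)
    case 0
    then show ?case by (auto simp: signed_binomial_def)
  next
    case (Suc b)
    then show ?case by (simp add: bdiff_def signed_binomial_Suc algebra_simps)
  qed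
  then show ?case by simp
next
  case (Suc a)
  then show ?case by (simp add: fdiff_def signed_binomial_Suc algebra_simps)
qed

lemma sum_fdiff_bdiff_step:
  assumes "1 \<le> k" "j \<le> n"
  shows "(\<Sum>x<Suc n. (fdiff ^^ j) ((bdiff ^^ j) (\<lambda>x. if int (n + k) \<le> x then 1 else 0)) (int x)) =
    (if j < k then 0 else (- 1) ^ (j - k) * of_nat ((2 * j - 2) choose (j - k)))"
proof (cases j)
  case 0
  then show ?thesis using assms by (auto intro!: sum.neutral)
next
  case (Suc i)
  let ?K = "int (n + k)"
  let ?\<phi> = "\<lambda>x. if ?K \<le> x then 1 else (0::rat)"
  let ?G = "(fdiff ^^ i) ((bdiff ^^ j) ?\<phi>)"
  have "bdiff ?\<phi> = (\<lambda>x. if x = ?K then 1 else 0)"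
    by (auto simp: bdiff_def fun_eq_iff)
  then have G: "?G x = signed_binomial (2 * i) (x - ?K + int i)" for x
    using fdiff_bdiff_power_indicator[of i i ?K x] by (simp add: Suc funpow_swap1 mult_2)
  have "(\<Sum>x<Suc n. (fdiff ^^ j) ((bdiff ^^ j) ?\<phi>) (int x)) = (\<Sum>x<Suc n. ?G (int (Suc x)) - ?G (int x))"
    unfolding Suc by (simp add: fdiff_def add.commute)
  also have "\<dots> = ?G (int (Suc n)) - ?G (int 0)"
    by (rule sum_lessThan_telescope)
  also have "?G (int 0) = 0" using assms Suc unfolding G by (simp add: signed_binomial_def)
  also have "?G (int (Suc n)) = signed_binomial (2 * i) (int j - int k)"
    using Suc unfolding G by (simp add: algebra_simps)
  also have "signed_binomial (2 * i) (int j - int k) =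
      (if j < k then 0 else (- 1) ^ (j - k) * of_nat ((2 * j - 2) choose (j - k)))"
  proof -
    have "nat (int j - int k) = j - k" "2 * i = 2 * j - 2" using Suc by auto
    then show ?thesis by (auto simp: signed_binomial_def)
  qed
  finally show ?thesis by (simp only: diff_0_right)
qed

text \<open>With \<open>N = n + 1\<close> variables, the number of variables that are at least
\<open>n + k\<close> replaces the condition \<open>k \<le> \<mu> 0\<close>.\<close>

lemma num_perms_LIS_ge_formula:
  assumes "1 \<le> k" "n \<le> 2 * k + 1"
  shows "of_nat (num_perms_LIS_ge n k) =
    (\<Sum>j\<in>{k..n}. (- 1) ^ (j - k) * of_nat ((2 * j - 2) choose (j - k)) *
       (of_nat (n choose j) * fact n / fact j) :: rat)"
proof -
  define N where "N = Suc n"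
  define \<phi> :: "int \<Rightarrow> rat" where "\<phi> = (\<lambda>x. if int (n + k) \<le> x then 1 else 0)"
  define w where "w = (\<lambda>l. (\<Sum>i<N. \<phi> (l i)) * (lower N ^^ n) (vacuum N) l)"
  have "represents N N w (\<lambda>\<mu>. (if k \<le> \<mu> 0 then 1 else 0) * num_tableaux n \<mu>)"
    unfolding represents_def
  proof safe
    fix \<mu> assume \<mu>: "\<mu> \<in> partitions" and zero: "\<forall>i\<ge>N. \<mu> i = 0"
    have eq: "num_tableaux n \<mu> = (lower N ^^ n) (vacuum N) (shifted_parts N \<mu>)"
      using represents_num_tableaux[of N n] \<mu> zero by (simp add: represents_def)
    show "(if k \<le> \<mu> 0 then 1 else 0) * num_tableaux n \<mu> = w (shifted_parts N \<mu>)"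
    proof (cases "num_tableaux n \<mu> = 0")
      case True
      then show ?thesis using eq by (simp add: w_def)
    next
      case False
      then have le: "\<mu> 0 + \<mu> 1 \<le> n" using num_tableaux_nonzero[OF \<mu>] by blast
      have "\<phi> (shifted_parts N \<mu> i) = (if i = 0 then if k \<le> \<mu> 0 then 1 else 0 else 0)"
        if "i < N" for i
      proof (cases "i = 0")
        case True
        then show ?thesis by (simp add: \<phi>_def shifted_parts_def staircase_def N_def)
      next
        case False
        \<comment> \<open>two rows longer than \<open>k\<close> need \<open>2 k + 2\<close> boxes\<close>
        have "\<mu> i \<le> \<mu> 1" "\<mu> 1 \<le> \<mu> 0" using \<mu> False by (auto simp: partitions_def antimono_def)
        then have "\<mu> i \<le> k" using le assms(2) by simp
        then show ?thesis using False that by (simp add: \<phi>_def shifted_parts_def staircase_def N_def)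
      qed
      then have "(\<Sum>i<N. \<phi> (shifted_parts N \<mu> i)) =
          (\<Sum>i<N. if i = 0 then if k \<le> \<mu> 0 then 1 else 0 else 0)"
        by (intro sum.cong) auto
      also have "\<dots> = (if k \<le> \<mu> 0 then 1 else 0)" by (simp add: N_def)
      finally show ?thesis using eq by (simp add: w_def)
    qed
  qed
  moreover have "alternating N w"
    unfolding w_def
    using alternating_hop[OF alternating_lower_power[OF alternating_vacuum], of N 0 \<phi> n]
    by (simp add: hop_def[abs_def] sum_distrib_right)
  ultimately have "represents N (N - n) ((raise N ^^ n) w)
      ((up ^^ n) (\<lambda>\<mu>. (if k \<le> \<mu> 0 then 1 else 0) * num_tableaux n \<mu>))"
    by (rule represents_raise_power) (simp add: N_def)
  moreover have c: "(\<Sum>x<N. (fdiff ^^ j) ((bdiff ^^ j) \<phi>) (int x)) =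
      (if j < k then 0 else (- 1) ^ (j - k) * of_nat ((2 * j - 2) choose (j - k)))" if "j \<le> n" for j
    using sum_fdiff_bdiff_step[OF assms(1) that] unfolding N_def \<phi>_def .
  ultimately have "of_nat (num_perms_LIS_ge n k) = (raise N ^^ n) w (staircase N)"
    using zero_in_partitions
    by (simp add: num_perms_LIS_ge_eq_up_power represents_def flip: shifted_parts_empty)
  also have "\<dots> = fact n * (\<Sum>j\<le>n. of_nat (n choose j) / fact j *
      (\<Sum>x<N. (fdiff ^^ j) ((bdiff ^^ j) \<phi>) (int x)))"
    unfolding w_def by (rule raise_power_one_body_lower_power) (auto simp: N_def \<phi>_def)
  also have "\<dots> = (\<Sum>j\<le>n. if j < k then 0 else (- 1) ^ (j - k) * of_nat ((2 * j - 2) choose (j - k)) *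
       (of_nat (n choose j) * fact n / fact j))"
    by (subst sum_distrib_left, intro sum.cong refl) (simp add: c)
  also have "\<dots> = (\<Sum>j\<in>{k..n}. if j < k then 0 else (- 1) ^ (j - k) * of_nat ((2 * j - 2) choose (j - k)) *
       (of_nat (n choose j) * fact n / fact j))"
    by (rule sum.mono_neutral_right) auto
  also have "\<dots> = (\<Sum>j\<in>{k..n}. (- 1) ^ (j - k) * of_nat ((2 * j - 2) choose (j - k)) *
       (of_nat (n choose j) * fact n / fact j))"
    by (intro sum.cong) auto
  finally show ?thesis .
qed

section \<open>Existence of a recurrence of order four for the sum\<close>

text \<open>Gaussian elimination without division: the last equation is used to eliminate one
unknown from the others, and the solution is scaled by the pivot.\<close>

lemma homogeneous_system_nontrivial_solution:
  fixes M :: "nat \<Rightarrow> nat \<Rightarrow> 'a::idom"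
  assumes "finite S" "e < card S"
  shows "\<exists>u. (\<exists>k\<in>S. u k \<noteq> 0) \<and> (\<forall>r<e. (\<Sum>k\<in>S. M r k * u k) = 0)"
  using assms
proof (induction e arbitrary: S M)
  case 0
  then have "S \<noteq> {}" by auto
  then show ?case by (intro exI[of _ "\<lambda>_. 1"]) auto
next
  case (Suc e)
  show ?case
  proof (cases "\<forall>k\<in>S. M e k = 0")
    case True
    obtain u where "\<exists>k\<in>S. u k \<noteq> 0" "\<forall>r<e. (\<Sum>k\<in>S. M r k * u k) = 0"
      using Suc.IH[OF Suc.prems(1), of M] Suc.prems(2) by auto
    then show ?thesis using True by (auto simp: less_Suc_eq)
  next
    case False
    then obtain k0 where k0: "k0 \<in> S" "M e k0 \<noteq> 0" by blast
    let ?S = "S - {k0}"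
    define M' where "M' = (\<lambda>r k. M e k0 * M r k - M r k0 * M e k)"
    have "e < card ?S" using Suc.prems k0 by simp
    then obtain u where u: "\<exists>k\<in>?S. u k \<noteq> 0" "\<forall>r<e. (\<Sum>k\<in>?S. M' r k * u k) = 0"
      using Suc.IH[of ?S M'] Suc.prems(1) by auto
    \<comment> \<open>The equation \<open>e\<close>, scaled by the pivot \<open>M e k0\<close>, determines the value at \<open>k0\<close>.\<close>
    define w where "w = (\<lambda>k. if k = k0 then - (\<Sum>k\<in>?S. M e k * u k) else M e k0 * u k)"
    have sum_w: "(\<Sum>k\<in>S. M r k * w k) = (\<Sum>k\<in>?S. M' r k * u k)" for r
    proof -
      have "(\<Sum>k\<in>S. M r k * w k) = M r k0 * w k0 + (\<Sum>k\<in>?S. M r k * w k)"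
        using Suc.prems(1) k0 by (simp add: sum.remove)
      also have "(\<Sum>k\<in>?S. M r k * w k) = (\<Sum>k\<in>?S. M e k0 * M r k * u k)"
        by (intro sum.cong refl) (simp add: w_def)
      also have "M r k0 * w k0 = (\<Sum>k\<in>?S. - (M r k0 * M e k * u k))"
        by (simp add: w_def sum_distrib_left sum_negf mult.assoc)
      also have "\<dots> + (\<Sum>k\<in>?S. M e k0 * M r k * u k) = (\<Sum>k\<in>?S. M' r k * u k)"
        unfolding sum.distrib[symmetric] by (intro sum.cong refl) (simp add: M'_def algebra_simps)
      finally show ?thesis .
    qed
    have "(\<Sum>k\<in>?S. M' e k * u k) = 0" by (simp add: M'_def)
    then have "\<forall>r<Suc e. (\<Sum>k\<in>S. M r k * w k) = 0"
      using u(2) by (auto simp: sum_w less_Suc_eq)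
    moreover have "\<exists>k\<in>S. w k \<noteq> 0"
      using u(1) k0 by (auto simp: w_def)
    ultimately show ?thesis by blast
  qed
qed

lemma polys_bounded_degree_dependent:
  fixes C :: "nat \<Rightarrow> 'a::idom poly"
  assumes "\<And>k. k < K \<Longrightarrow> degree (C k) \<le> d" "Suc d < K"
  shows "\<exists>u. (\<exists>k<K. u k \<noteq> 0) \<and> (\<Sum>k<K. smult (u k) (C k)) = 0"
proof -
  obtain u where u: "\<exists>k\<in>{..<K}. u k \<noteq> 0"
      "\<forall>r<Suc d. (\<Sum>k\<in>{..<K}. coeff (C k) r * u k) = 0"
    using homogeneous_system_nontrivial_solution[of "{..<K}" "Suc d" "\<lambda>r k. coeff (C k) r"] assms(2)
    by auto
  have "coeff (\<Sum>k<K. smult (u k) (C k)) r = 0" for r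
  proof (cases "r < Suc d")
    case True
    then show ?thesis using u(2) by (simp add: coeff_sum mult.commute)
  next
    case False
    then have "coeff (C k) r = 0" if "k < K" for k
      using assms(1)[OF that] by (intro coeff_eq_0) simp
    then show ?thesis by (simp add: coeff_sum)
  qed
  then have "(\<Sum>k<K. smult (u k) (C k)) = 0" by (simp add: poly_eq_iff)
  then show ?thesis using u(1) by auto
qed

text \<open>A type \<open>rat poly poly\<close> stands for polynomials in the summation index
\<open>i\<close> whose coefficients are polynomials in the parameter \<open>m\<close>;
\<open>affine a b c\<close> is \<open>a * i + b * m + c\<close>.\<close>

definition affine :: "rat \<Rightarrow> rat \<Rightarrow> rat \<Rightarrow> rat poly poly" where
  "affine a b c = [:[:c, b:], [:a:]:]"

definition rising :: "rat \<Rightarrow> rat \<Rightarrow> rat \<Rightarrow> nat \<Rightarrow> rat poly poly" where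
  "rising a b c k = (\<Prod>t<k. affine a b (c + of_nat t))"

definition eval2 :: "rat poly poly \<Rightarrow> rat \<Rightarrow> rat \<Rightarrow> rat" where
  "eval2 P m i = poly (poly P [:i:]) m"

lemma eval2_simps [simp]:
  "eval2 (P + Q) m i = eval2 P m i + eval2 Q m i"
  "eval2 (P * Q) m i = eval2 P m i * eval2 Q m i"
  "eval2 (- P) m i = - eval2 P m i"
  "eval2 (P - Q) m i = eval2 P m i - eval2 Q m i"
  "eval2 (P ^ k) m i = eval2 P m i ^ k"
  "eval2 (smult p P) m i = poly p m * eval2 P m i"
  "eval2 (affine a b c) m i = a * i + b * m + c"
  by (simp_all add: eval2_def affine_def poly_power algebra_simps)

lemma eval2_sum: "eval2 (\<Sum>k\<in>S. P k) m i = (\<Sum>k\<in>S. eval2 (P k) m i)"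
  by (simp add: eval2_def poly_sum)

lemma eval2_rising [simp]: "eval2 (rising a b c k) m i = pochhammer (a * i + b * m + c) k"
proof (induction k)
  case (Suc k)
  have "rising a b c (Suc k) = rising a b c k * affine a b (c + of_nat k)"
    by (simp add: rising_def)
  then show ?case using Suc by (simp add: pochhammer_Suc add.assoc)
qed (simp add: rising_def eval2_def)

lemma degree_affine_le: "degree (affine a b c) \<le> 1"
  by (simp add: affine_def)

lemma degree_rising_le: "degree (rising a b c k) \<le> k"
proof -
  have "degree (rising a b c k) \<le> (\<Sum>t<k. degree (affine a b (c + of_nat t)))"
    unfolding rising_def using degree_prod_sum_le[of "{..<k}" "\<lambda>t. affine a b (c + of_nat t)"]
    by (simp add: o_def)
  also have "\<dots> \<le> (\<Sum>t<k. 1)" by (intro sum_mono degree_affine_le)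
  finally show ?thesis by simp
qed

lemma degree_rising_0: "degree (rising 0 b c k) = 0"
proof -
  have "degree (rising 0 b c k) \<le> (\<Sum>t<k. degree (affine 0 b (c + of_nat t)))"
    unfolding rising_def using degree_prod_sum_le[of "{..<k}" "\<lambda>t. affine 0 b (c + of_nat t)"]
    by (simp add: o_def)
  then show ?thesis by (simp add: affine_def)
qed

lemma fact_add: "fact (x + k) = (fact x :: rat) * pochhammer (of_nat x + 1) k"
  by (induction k) (simp_all add: pochhammer_Suc algebra_simps)

text \<open>The terms of \<open>num_perms_LIS_ge_formula\<close> for the numbers \<open>2 * (m +
1)\<close> and \<open>m + 1\<close>, with \<open>i = j - (m + 1)\<close>. Counting from \<open>m =
0\<close> avoids truncated subtractions inside the factorials.\<close>

definition summand :: "nat \<Rightarrow> nat \<Rightarrow> rat" where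
  "summand m i = (if i \<le> m + 1 then (-1)^i * fact (2 * m + 2 * i) * fact (2 * m + 2) ^ 2 /
     (fact i * fact (2 * m + i) * fact (m + 1 + i) ^ 2 * fact (m + 1 - i)) else 0)"

text \<open>A hypergeometric term of which \<open>summand m i\<close>, ..., \<open>summand (m + 4)
i\<close> are polynomial multiples; the multipliers are given by
\<open>shift_factor\<close>.\<close>

definition common_factor :: "nat \<Rightarrow> nat \<Rightarrow> rat" where
  "common_factor m i = (if i \<le> m + 5 then (-1)^i * fact (2 * m + 2 * i) * fact (2 * m + 2) ^ 2 /
     (fact i * fact (2 * m + 8 + i) * fact (m + 5 + i) ^ 2 * fact (m + 5 - i)) else 0)"

definition shift_factor :: "nat \<Rightarrow> rat poly poly" where
  "shift_factor s = rising 2 2 1 (2 * s) * rising 0 2 3 (2 * s) ^ 2 *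
     rising 1 2 (of_nat (2 * s + 1)) (8 - 2 * s) *
     rising 1 1 (of_nat (s + 2)) (4 - s) ^ 2 * rising (- 1) 1 (of_nat (s + 2)) (4 - s)"

text \<open>The ratio of consecutive common factors is the quotient of \<open>gosper_q\<close> at
\<open>i\<close> and \<open>gosper_r\<close> at \<open>i + 1\<close>. Both ends of the summation
range are zeros: \<open>gosper_q\<close> vanishes at \<open>i = m + 5\<close> and
\<open>gosper_r\<close> at \<open>i = 0\<close>.\<close>

definition gosper_q :: "rat poly poly" where
  "gosper_q = - (affine 2 2 1 * affine 2 2 2 * affine (- 1) 1 5)"

definition gosper_r :: "rat poly poly" where
  "gosper_r = affine 1 0 0 * affine 1 2 8 * affine 1 1 5 ^ 2"

lemma summand_shift:
  assumes s: "s \<le> 4" and i: "i \<le> m + 5"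
  shows "summand (m + s) i = common_factor m i * eval2 (shift_factor s) (of_nat m) (of_nat i)"
proof -
  let ?P5 = "pochhammer (- of_nat i + of_nat m + of_nat (s + 2)) (4 - s) :: rat"
  show ?thesis
  proof (cases "i \<le> m + s + 1")
    case True
    have f1: "fact (2 * (m + s) + 2 * i) = fact (2 * m + 2 * i) * (pochhammer (2 * of_nat i + 2 * of_nat m + 1) (2 * s) :: rat)"
      using fact_add[of "2 * m + 2 * i" "2 * s"] by (simp add: algebra_simps)
    have f2: "fact (2 * (m + s) + 2) = fact (2 * m + 2) * (pochhammer (2 * of_nat m + 3) (2 * s) :: rat)"
      using fact_add[of "2 * m + 2" "2 * s"] by (simp add: algebra_simps)
    have "2 * (m + s) + i + (8 - 2 * s) = 2 * m + 8 + i" using s by simp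
    then have f3: "fact (2 * m + 8 + i) = fact (2 * (m + s) + i) *
        (pochhammer (of_nat i + 2 * of_nat m + of_nat (2 * s + 1)) (8 - 2 * s) :: rat)"
      using fact_add[of "2 * (m + s) + i" "8 - 2 * s"] by (simp add: algebra_simps)
    have "m + s + 1 + i + (4 - s) = m + 5 + i" using s by simp
    then have f4: "fact (m + 5 + i) = fact (m + s + 1 + i) *
        (pochhammer (of_nat i + of_nat m + of_nat (s + 2)) (4 - s) :: rat)"
      using fact_add[of "m + s + 1 + i" "4 - s"] by (simp add: algebra_simps)
    have "m + s + 1 - i + (4 - s) = m + 5 - i" using s True by simp
    moreover have "(of_nat (m + s + 1 - i) :: rat) + 1 = - of_nat i + of_nat m + of_nat (s + 2)"
      using True by (simp add: of_nat_diff)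
    ultimately have f5: "fact (m + 5 - i) = fact (m + s + 1 - i) * ?P5"
      using fact_add[of "m + s + 1 - i" "4 - s"] by (simp only:)
    have alg: "sg * (A * p1) * (B * p2)\<^sup>2 / (F * C * D\<^sup>2 * E) =
        sg * A * B\<^sup>2 / (F * (C * p3) * (D * p4)\<^sup>2 * (E * p5)) * (p1 * p2\<^sup>2 * p3 * p4\<^sup>2 * p5)"
      if "p3 \<noteq> 0" "p4 \<noteq> 0" "p5 \<noteq> 0" for sg A p1 B p2 F C D E p3 p4 p5 :: rat
      using that by (simp add: field_simps)
    have nz: "pochhammer (of_nat i + 2 * of_nat m + of_nat (2 * s + 1)) (8 - 2 * s) \<noteq> (0::rat)"
      "pochhammer (of_nat i + of_nat m + of_nat (s + 2)) (4 - s) \<noteq> (0::rat)" "?P5 \<noteq> 0"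
      using f3 f4 f5 fact_nonzero mult_zero_right by metis+
    have "summand (m + s) i = (-1)^i * fact (2 * (m + s) + 2 * i) * (fact (2 * (m + s) + 2))\<^sup>2 /
        (fact i * fact (2 * (m + s) + i) * (fact (m + s + 1 + i))\<^sup>2 * fact (m + s + 1 - i))"
      using True by (simp add: summand_def)
    also have "\<dots> = (-1)^i * fact (2 * m + 2 * i) * (fact (2 * m + 2))\<^sup>2 /
        (fact i * fact (2 * m + 8 + i) * (fact (m + 5 + i))\<^sup>2 * fact (m + 5 - i)) *
        eval2 (shift_factor s) (of_nat m) (of_nat i)"
      unfolding f1 f2 f3 f4 f5 alg[OF nz] by (simp add: shift_factor_def)
    finally show ?thesis using i by (simp add: common_factor_def)
  next
    case False
    have "- of_nat i + of_nat m + of_nat (s + 2) = (- of_nat (i - (m + s + 2)) :: rat)"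
      using False by (simp add: of_nat_diff)
    moreover have "i - (m + s + 2) < 4 - s" using False i s by simp
    ultimately have "?P5 = 0" by (simp only: pochhammer_of_nat_eq_0_lemma)
    then show ?thesis using False by (simp add: summand_def shift_factor_def)
  qed
qed

lemma gosper_common_factor:
  assumes "i < m + 5"
  shows "eval2 gosper_q (of_nat m) (of_nat i) * common_factor m i =
         eval2 gosper_r (of_nat m) (of_nat (Suc i)) * common_factor m (Suc i)"
proof -
  obtain d where d: "m + 5 = Suc (i + d)" using assms less_imp_Suc_add by blast
  have e: "m + 5 - i = Suc d" "m + 5 - Suc i = d" using d by auto
  have md: "(of_nat m :: rat) + 5 - of_nat i = 1 + of_nat d"
    using arg_cong[OF d, of "of_nat :: nat \<Rightarrow> rat"] by simp
  have f1: "fact (2 * m + 2 * Suc i) = (2 * of_nat m + 2 * of_nat i + 2) *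
      ((2 * of_nat m + 2 * of_nat i + 1) * (fact (2 * m + 2 * i) :: rat))"
    by (simp add: algebra_simps)
  have f2: "fact (2 * m + 8 + Suc i) = (2 * of_nat m + 9 + of_nat i) * (fact (2 * m + 8 + i) :: rat)"
    unfolding add_Suc_right fact_Suc by simp
  have f3: "fact (m + 5 + Suc i) = (of_nat m + 6 + of_nat i) * (fact (m + 5 + i) :: rat)"
    unfolding add_Suc_right fact_Suc by simp
  have f4: "fact (Suc i) = (of_nat i + 1) * (fact i :: rat)" by (simp add: algebra_simps)
  have f5: "fact (m + 5 - i) = (of_nat m + 5 - of_nat i) * (fact (m + 5 - Suc i) :: rat)"
    unfolding e md by (simp add: algebra_simps)
  have nz: "of_nat i + 1 \<noteq> (0::rat)" "2 * of_nat m + 9 + of_nat i \<noteq> (0::rat)"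
    "of_nat m + 6 + of_nat i \<noteq> (0::rat)" "of_nat m + 5 - of_nat i \<noteq> (0::rat)"
    unfolding md using of_nat_0_le_iff[of m, where 'a = rat] of_nat_0_le_iff[of i, where 'a = rat]
      of_nat_0_le_iff[of d, where 'a = rat] by linarith+
  have alg: "- (a * b * c) * (sg * A * B\<^sup>2 / (F * C * D\<^sup>2 * (c * E))) =
      (f * g * h\<^sup>2) * ((- 1 * sg) * (b * (a * A)) * B\<^sup>2 / ((f * F) * (g * C) * (h * D)\<^sup>2 * E))"
    if "f \<noteq> 0" "g \<noteq> 0" "h \<noteq> 0" "c \<noteq> 0" for a b c sg A B F C D E f g h :: rat
    using that by (simp add: field_simps)
  have "eval2 gosper_q (of_nat m) (of_nat i) * common_factor m i =
      - ((2 * of_nat m + 2 * of_nat i + 1) * (2 * of_nat m + 2 * of_nat i + 2) * (of_nat m + 5 - of_nat i)) *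
      ((-1)^i * fact (2 * m + 2 * i) * (fact (2 * m + 2))\<^sup>2 /
      (fact i * fact (2 * m + 8 + i) * (fact (m + 5 + i))\<^sup>2 *
        ((of_nat m + 5 - of_nat i) * fact (m + 5 - Suc i))))"
  proof -
    have "eval2 gosper_q (of_nat m) (of_nat i) = - ((2 * of_nat m + 2 * of_nat i + 1) *
        (2 * of_nat m + 2 * of_nat i + 2) * (of_nat m + 5 - of_nat i))"
      by (simp add: gosper_q_def algebra_simps)
    moreover have "i \<le> m + 5" using assms by simp
    ultimately show ?thesis by (simp only: common_factor_def if_True f5)
  qed
  also have "\<dots> = ((of_nat i + 1) * (2 * of_nat m + 9 + of_nat i) * (of_nat m + 6 + of_nat i)\<^sup>2) *
      ((-1) ^ Suc i * fact (2 * m + 2 * Suc i) * (fact (2 * m + 2))\<^sup>2 /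
      (fact (Suc i) * fact (2 * m + 8 + Suc i) * (fact (m + 5 + Suc i))\<^sup>2 * fact (m + 5 - Suc i)))"
    unfolding f1 f2 f3 f4 power_Suc by (rule alg[OF nz])
  also have "\<dots> = eval2 gosper_r (of_nat m) (of_nat (Suc i)) * common_factor m (Suc i)"
  proof -
    have "eval2 gosper_r (of_nat m) (of_nat (Suc i)) =
        (of_nat i + 1) * (2 * of_nat m + 9 + of_nat i) * (of_nat m + 6 + of_nat i)\<^sup>2"
      by (simp add: gosper_r_def algebra_simps)
    moreover have "common_factor m (Suc i) = (-1) ^ Suc i * fact (2 * m + 2 * Suc i) * (fact (2 * m + 2))\<^sup>2 /
      (fact (Suc i) * fact (2 * m + 8 + Suc i) * (fact (m + 5 + Suc i))\<^sup>2 * fact (m + 5 - Suc i))"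
      using assms unfolding common_factor_def by (simp only: Suc_le_eq if_True)
    ultimately show ?thesis by simp
  qed
  finally show ?thesis .
qed

lemma degree_shift_factor:
  assumes "s \<le> 4"
  shows "degree (shift_factor s) \<le> 20"
proof -
  have m: "degree P \<le> x \<Longrightarrow> degree Q \<le> y \<Longrightarrow> degree (P * Q) \<le> x + y" for P Q :: "rat poly poly" and x y
    using degree_mult_le[of P Q] by simp
  have p: "degree P \<le> x \<Longrightarrow> degree (P ^ k) \<le> x * k" for P :: "rat poly poly" and x k
    using degree_power_le[of P k] by (meson le_trans mult_le_mono1)
  have "degree (shift_factor s) \<le> 2 * s + 0 * 2 + (8 - 2 * s) + (4 - s) * 2 + (4 - s)"
    unfolding shift_factor_def
    by (intro m p degree_rising_le) (simp add: degree_rising_0)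
  then show ?thesis using assms by simp
qed

lemma degree_gosper_q: "degree gosper_q = 3"
proof -
  have a: "degree (affine a b c) = 1" "affine a b c \<noteq> 0" if "a \<noteq> 0" for a b c
    using that by (simp_all add: affine_def)
  show ?thesis unfolding gosper_q_def by (simp add: degree_mult_eq a)
qed

lemma degree_gosper_r: "degree gosper_r = 4"
proof -
  have a: "degree (affine a b c) = 1" "affine a b c \<noteq> 0" if "a \<noteq> 0" for a b c
    using that by (simp_all add: affine_def)
  show ?thesis unfolding gosper_r_def by (simp add: degree_mult_eq degree_power_eq a)
qed

text \<open>The two sides have different degrees unless \<open>x\<close> is zero.\<close>

lemma gosper_operator_injective:
  assumes "gosper_q * pcompose x [:1, 1:] = gosper_r * x"
  shows "x = 0"
proof (rule ccontr)
  assume x: "x \<noteq> 0"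
  have "pcompose x [:1, 1:] \<noteq> 0"
    using x by (auto dest: pcompose_eq_0)
  moreover have "gosper_q \<noteq> 0" "gosper_r \<noteq> 0"
    using degree_gosper_q degree_gosper_r by auto
  ultimately have "3 + degree (pcompose x [:1, 1:]) = 4 + degree x"
    using arg_cong[OF assms, of degree] x by (simp add: degree_mult_eq degree_gosper_q degree_gosper_r)
  then show False by (simp add: degree_pcompose)
qed

text \<open>Unknown are five coefficients \<open>p s\<close> and the seventeen coefficients of
\<open>x\<close>, all in \<open>rat poly\<close>; the equation is one between polynomials of
degree at most 20 in the summation index, so that there are more unknowns than equations.\<close>

lemma creative_telescoping:
  obtains p :: "nat \<Rightarrow> rat poly" and x :: "rat poly poly" where "\<exists>s\<le>4. p s \<noteq> 0"
    "(\<Sum>s\<le>4. smult (p s) (shift_factor s)) = gosper_q * pcompose x [:1, 1:] - gosper_r * x"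
proof -
  define X :: "rat poly poly" where "X = [:0, 1:]"
  define L where "L = (\<lambda>x. gosper_q * pcompose x [:1, 1:] - gosper_r * x)"
  define C where "C = (\<lambda>k. if k < 5 then shift_factor k else - L (X ^ (k - 5)))"
  have "degree (L (X ^ e)) \<le> e + 4" for e
  proof -
    have dX: "degree (X ^ e) = e" by (simp add: X_def degree_power_eq)
    have "degree (gosper_q * pcompose (X ^ e) [:1, 1:]) \<le> 3 + e"
      using degree_mult_le[of gosper_q "pcompose (X ^ e) [:1, 1:]"]
      by (simp add: degree_pcompose dX degree_gosper_q)
    moreover have "degree (gosper_r * X ^ e) \<le> 4 + e"
      using degree_mult_le[of gosper_r "X ^ e"] by (simp add: dX degree_gosper_r)
    ultimately show ?thesis unfolding L_def by (intro degree_diff_le) auto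
  qed
  then have degC: "degree (C k) \<le> 20" if "k < 22" for k
    using that degree_shift_factor[of k] le_trans[of "degree (L (X ^ (k - 5)))" "k - 5 + 4" 20]
    by (auto simp: C_def)
  obtain u where u: "\<exists>k<22. u k \<noteq> 0" "(\<Sum>k<22. smult (u k) (C k)) = 0"
    using polys_bounded_degree_dependent[of 22 C 20, OF degC] by auto
  define x where "x = (\<Sum>e<17. smult (u (5 + e)) (X ^ e))"
  have Lx: "L x = (\<Sum>e<17. smult (u (5 + e)) (L (X ^ e)))"
    by (simp add: L_def x_def pcompose_sum pcompose_smult sum_distrib_left sum_subtractf
        smult_diff_right)
  have "(\<Sum>k<22. smult (u k) (C k)) = (\<Sum>k<5. smult (u k) (C k)) + (\<Sum>e<17. smult (u (5 + e)) (C (5 + e)))"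
    using sum.atLeastLessThan_concat[of 0 5 22 "\<lambda>k. smult (u k) (C k)"]
      sum.shift_bounds_nat_ivl[of "\<lambda>k. smult (u k) (C k)" 0 5 17]
    by (simp add: atLeast0LessThan add.commute)
  also have "(\<Sum>k<5. smult (u k) (C k)) = (\<Sum>k\<le>4. smult (u k) (shift_factor k))"
    by (intro sum.cong) (auto simp: C_def)
  also have "(\<Sum>e<17. smult (u (5 + e)) (C (5 + e))) = - L x"
    by (simp add: C_def Lx sum_negf)
  finally have eq: "(\<Sum>s\<le>4. smult (u s) (shift_factor s)) = L x" using u(2) by simp
  have "\<exists>s\<le>4. u s \<noteq> 0"
  proof (rule ccontr)
    assume none: "\<not> (\<exists>s\<le>4. u s \<noteq> 0)"
    then have "L x = 0" using eq by simp
    then have "x = 0" using gosper_operator_injective by (simp add: L_def)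
    have "u (5 + e) = 0" if "e < 17" for e
    proof -
      have "coeff x e = (\<Sum>e'<17. if e' = e then u (5 + e') else 0)"
        unfolding x_def coeff_sum by (intro sum.cong) (simp_all add: X_def flip: monom_altdef)
      then show ?thesis using that \<open>x = 0\<close> by simp
    qed
    moreover have "u k = 0" if "k < 5" for k using none that by auto
    ultimately have "u k = 0" if "k < 22" for k
      using that by (cases "k < 5") (auto simp: not_less dest!: le_Suc_ex)
    then show False using u(1) by blast
  qed
  then show thesis using that[of u x] eq by (simp add: L_def)
qed

lemma summand_recurrence:
  "\<exists>p :: nat \<Rightarrow> rat poly. (\<exists>s\<le>4. p s \<noteq> 0) \<and>
    (\<forall>m. (\<Sum>s\<le>4. poly (p s) (of_nat m) * (\<Sum>i\<le>m + s + 1. summand (m + s) i)) = 0)"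
proof -
  obtain p :: "nat \<Rightarrow> rat poly" and x where nz: "\<exists>s\<le>4. p s \<noteq> 0" and
    eq: "(\<Sum>s\<le>4. smult (p s) (shift_factor s)) = gosper_q * pcompose x [:1, 1:] - gosper_r * x"
    by (rule creative_telescoping)
  have "(\<Sum>s\<le>4. poly (p s) (of_nat m) * (\<Sum>i\<le>m + s + 1. summand (m + s) i)) = 0" for m
  proof -
    let ?m = "of_nat m :: rat"
    \<comment> \<open>the telescoping antidifference in \<open>i\<close>\<close>
    define G where "G = (\<lambda>i. if i \<le> m + 5
      then eval2 gosper_r ?m (of_nat i) * eval2 x ?m (of_nat i) * common_factor m i else 0)"
    have xs: "eval2 (pcompose x [:1, 1:]) ?m i = eval2 x ?m (i + 1)" for i
      by (simp add: eval2_def poly_pcompose algebra_simps one_pCons)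
    have step: "(\<Sum>s\<le>4. poly (p s) ?m * summand (m + s) i) = G (Suc i) - G i" if i: "i \<le> m + 5" for i
    proof -
      have "(\<Sum>s\<le>4. poly (p s) ?m * summand (m + s) i) =
          common_factor m i * eval2 (\<Sum>s\<le>4. smult (p s) (shift_factor s)) ?m (of_nat i)"
        unfolding eval2_sum sum_distrib_left
        by (intro sum.cong refl) (use summand_shift i in simp)
      also have "\<dots> = (eval2 gosper_q ?m (of_nat i) * common_factor m i) * eval2 x ?m (of_nat (Suc i)) - G i"
        unfolding eq using i by (simp add: xs G_def algebra_simps)
      also have "(eval2 gosper_q ?m (of_nat i) * common_factor m i) * eval2 x ?m (of_nat (Suc i)) = G (Suc i)"
      proof (cases "i < m + 5")
        case True
        then show ?thesis unfolding gosper_common_factor[OF True] by (simp add: G_def)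
      next
        case False
        then have "i = m + 5" using i by simp
        then show ?thesis by (simp add: G_def gosper_q_def)
      qed
      finally show ?thesis .
    qed
    have ext: "(\<Sum>i\<le>m + s + 1. summand (m + s) i) = (\<Sum>i<m + 6. summand (m + s) i)" if "s \<le> 4" for s
      using that by (intro sum.mono_neutral_left) (auto simp: summand_def)
    have "(\<Sum>s\<le>4. poly (p s) ?m * (\<Sum>i\<le>m + s + 1. summand (m + s) i)) =
        (\<Sum>s\<le>4. \<Sum>i<m + 6. poly (p s) ?m * summand (m + s) i)"
      by (intro sum.cong refl) (use ext in \<open>simp add: sum_distrib_left\<close>)
    also have "\<dots> = (\<Sum>i<m + 6. \<Sum>s\<le>4. poly (p s) ?m * summand (m + s) i)" by (rule sum.swap)
    also have "\<dots> = (\<Sum>i<m + 6. G (Suc i) - G i)"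
      by (intro sum.cong refl step) auto
    also have "\<dots> = G (m + 6) - G 0" by (rule sum_lessThan_telescope)
    also have "\<dots> = 0" by (simp add: G_def gosper_r_def)
    finally show ?thesis .
  qed
  then show ?thesis using nz by blast
qed

section \<open>The recurrence for the numbers of permutations\<close>

lemma central_num_perms_LIS_ge:
  "of_nat (num_perms_LIS_ge (2 * (m + 1)) (m + 1)) = (\<Sum>i\<le>m + 1. summand m i)"
proof -
  let ?t = "\<lambda>j. (- 1) ^ (j - (m + 1)) * of_nat ((2 * j - 2) choose (j - (m + 1))) *
       (of_nat (2 * (m + 1) choose j) * fact (2 * (m + 1)) / fact j) :: rat"
  have "of_nat (num_perms_LIS_ge (2 * (m + 1)) (m + 1)) = (\<Sum>j\<in>{m + 1..2 * (m + 1)}. ?t j)"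
    by (rule num_perms_LIS_ge_formula) auto
  also have "\<dots> = (\<Sum>i\<in>{0..m + 1}. ?t (i + (m + 1)))"
  proof -
    have "{m + 1..2 * (m + 1)} = {0 + (m + 1)..(m + 1) + (m + 1)}" by simp
    then show ?thesis by (simp only: sum.shift_bounds_cl_nat_ivl)
  qed
  also have "\<dots> = (\<Sum>i\<le>m + 1. summand m i)"
  proof (intro sum.cong)
    fix i assume "i \<in> {..m + 1}"
    then have i: "i \<le> m + 1" by simp
    have e: "2 * (m + 1 + i) - 2 = 2 * m + 2 * i" "m + 1 + i - (m + 1) = i"
      "2 * m + 2 * i - i = 2 * m + i" "2 * (m + 1) - (m + 1 + i) = m + 1 - i"
      "i + (m + 1) = m + 1 + i" "2 * (m + 1) = 2 * m + 2" by auto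
    have c1: "of_nat (2 * m + 2 * i choose i) = (fact (2 * m + 2 * i) / (fact i * fact (2 * m + i)) :: rat)"
      using binomial_fact[of i "2 * m + 2 * i", where 'a = rat] by (simp add: e(3))
    have c2: "of_nat (2 * m + 2 choose (m + 1 + i)) =
        (fact (2 * m + 2) / (fact (m + 1 + i) * fact (m + 1 - i)) :: rat)"
      using binomial_fact[of "m + 1 + i" "2 * m + 2", where 'a = rat] i e(4,6) by (simp only: e)
    have "?t (i + (m + 1)) = (- 1) ^ i * of_nat (2 * m + 2 * i choose i) *
        (of_nat (2 * m + 2 choose (m + 1 + i)) * fact (2 * m + 2) / fact (m + 1 + i))"
      by (simp only: e)
    also have "\<dots> = summand m i"
      unfolding c1 c2 using i by (simp add: summand_def power2_eq_square field_simps del: fact_Suc)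
    finally show "?t (i + (m + 1)) = summand m i" .
  qed auto
  finally show ?thesis .
qed

text \<open>If the leading nonzero coefficient has index \<open>r < d\<close>, the recurrence is
used at an argument that is larger by \<open>d - r\<close>, so that its coefficients move up by
\<open>d - r\<close>. The hypothesis starts at the term \<open>a 1\<close>.\<close>

lemma recurrence_with_top_coefficient:
  fixes a :: "nat \<Rightarrow> 'a::field_char_0"
  assumes "\<exists>s\<le>d. p s \<noteq> 0"
    "\<And>m. (\<Sum>s\<le>d. poly (p s) (of_nat m) * a (m + 1 + s)) = 0"
  shows "\<exists>q. q d \<noteq> 0 \<and> linear_recurrence_from 1 d q a"
proof -
  define r where "r = Max {s. s \<le> d \<and> p s \<noteq> 0}"
  have "r \<in> {s. s \<le> d \<and> p s \<noteq> 0}" unfolding r_def using assms(1) by (intro Max_in) auto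
  then have r: "r \<le> d" "p r \<noteq> 0" by auto
  have above: "p s = 0" if "r < s" "s \<le> d" for s
  proof (rule ccontr)
    assume "p s \<noteq> 0"
    then have "s \<le> r" unfolding r_def using that(2) by (intro Max_ge) auto
    then show False using that(1) by simp
  qed
  define c where "c = d - r"
  define q where "q = (\<lambda>i. if c \<le> i then pcompose (p (i - c)) [:of_nat c - 1, 1:] else 0)"
  have "q d \<noteq> 0"
    using r by (auto simp: q_def c_def dest!: pcompose_eq_0)
  moreover have "(\<Sum>i\<le>d. poly (q i) (of_nat n) * a (n + i)) = 0" if n: "1 \<le> n" for n
  proof -
    define m where "m = n - 1 + c"
    have m: "(of_nat m :: 'a) = of_nat c - 1 + of_nat n"
      using n by (simp add: m_def of_nat_diff)
    have "(\<Sum>i\<le>d. poly (q i) (of_nat n) * a (n + i)) = (\<Sum>i\<in>{0 + c..r + c}. poly (q i) (of_nat n) * a (n + i))"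
      using r(1) by (intro sum.mono_neutral_right) (auto simp: q_def c_def)
    also have "\<dots> = (\<Sum>s\<in>{0..r}. poly (q (s + c)) (of_nat n) * a (n + (s + c)))"
      by (rule sum.shift_bounds_cl_nat_ivl)
    also have "\<dots> = (\<Sum>s\<in>{0..r}. poly (p s) (of_nat m) * a (m + 1 + s))"
    proof (rule sum.cong[OF refl])
      fix s
      have ix: "n + (s + c) = m + 1 + s" using n by (simp add: m_def)
      show "poly (q (s + c)) (of_nat n) * a (n + (s + c)) = poly (p s) (of_nat m) * a (m + 1 + s)"
        unfolding ix by (simp add: q_def poly_pcompose m)
    qed
    also have "\<dots> = (\<Sum>s\<le>d. poly (p s) (of_nat m) * a (m + 1 + s))"
      using r(1) above by (intro sum.mono_neutral_left) auto
    finally show ?thesis using assms(2) by simp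
  qed
  ultimately show ?thesis unfolding linear_recurrence_from_def by blast
qed

theorem mainTheorem3:
  "D_finite_from 1 (\<lambda>n. of_nat (num_perms_LIS_ge (2 * n) n) :: rat) \<and>
   (\<exists>p :: nat \<Rightarrow> rat poly. p 4 \<noteq> 0 \<and>
      (\<forall>n\<ge>1. (\<Sum>i\<le>4. poly (p i) (of_nat n) * of_nat (num_perms_LIS_ge (2 * (n + i)) (n + i))) = 0))"
proof -
  let ?b = "\<lambda>n. of_nat (num_perms_LIS_ge (2 * n) n) :: rat"
  obtain p :: "nat \<Rightarrow> rat poly" where p: "\<exists>s\<le>4. p s \<noteq> 0"
    "\<And>m. (\<Sum>s\<le>4. poly (p s) (of_nat m) * (\<Sum>i\<le>m + s + 1. summand (m + s) i)) = 0"
    using summand_recurrence by blast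
  have "?b (m + 1 + s) = (\<Sum>i\<le>m + s + 1. summand (m + s) i)" for m s
    using central_num_perms_LIS_ge[of "m + s"] by (simp add: add.commute add.left_commute)
  then have "(\<Sum>s\<le>4. poly (p s) (of_nat m) * ?b (m + 1 + s)) = 0" for m
    using p(2)[of m] by (simp only:)
  then obtain q where "q 4 \<noteq> 0" "linear_recurrence_from 1 4 q ?b"
    using recurrence_with_top_coefficient[OF p(1), of ?b] by blast
  then show ?thesis
    unfolding D_finite_from_def linear_recurrence_from_def by blast
qed

end
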